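(* Assume $g$ is concave on $I=[-1,1]$. There is a subsequence $\{n_i\}$ of the integers such that the limits $\lambda=\lim_{i\to\infty}\lambda_{n_i}$ and $v(a)=\lim_{i\to\infty}v_{n_i}(a)$, $a\in Or(g)=\{g^{\circ n}(0)\}_{n=1}^\infty$, exist, and the continuous extension (to $\Lambda$) of the limit $v=\lim_{i\to\infty}v_{n_i}$ on the critical orbit $Or(g)$ is an eigenvector of $\mathcal{L}_{\varphi,B}$ with the eigenvalue $\lambda$.
   Context: Let $I=[-1,1]$ and let $g:I\to I$ be the (Feigenbaum) fixed point of the period doubling operator: $g$ is an even analytic folding mapping with unique non-degenerate critical point $0$, with $g(0)=1$, $g^{\circ 3}(0)>-g^{\circ 2}(0)>g^{\circ 4}(0)>0>g^{\circ 2}(0)$, and $g(x)=-\alpha\, g\circ g(-\alpha^{-1}x)$ where $\alpha=-1/g(1)$. Put $J=g(I)=[g(1),1]$, $J_0=[g(1),g^{\circ 3}(1)]$, $J_1=[g^{\circ 2}(1),1]$. Define $\sigma:J_0\cup J_1\to J$ by $\sigma(x)=-\alpha x$ on $J_0$ and $\sigma(x)=-\alpha g(x)$ on $J_1$; it is expanding and maps each of $J_0,J_1$ bijectively onto $J$. Let $\varphi=\sigma'$ and let $\Lambda$ be the maximal invariant set of $\sigma$ (the points of $J_0\cup J_1$ all of whose forward iterates under $\sigma$ stay in $J_0\cup J_1$); $\Lambda$ is the closure of $Or(g)$. $\mathcal{V}^b(\Lambda)$ is the space of bounded real vector fields (functions) on $\Lambda$, and $\mathcal{L}_{\varphi,B}:\mathcal{V}^b(\Lambda)\to\mathcal{V}^b(\Lambda)$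 is $(\mathcal{L}_{\varphi,B}v)(x)=\sum_{y\in\sigma^{-1}(x)}\varphi(y)v(y)$. For $n\ge1$, $\sigma^{-n}(J)$ is a union of $2^n$ disjoint closed intervals $J_{n1},\dots,J_{n2^n}$ labelled from left to right; write $J_{n(2^{n-1}+i)}=[a_{ni},b_{ni}]$ and $\beta_{ni}=|g'(b_{ni})|$ for $i=1,\dots,2^{n-1}$. Define $\varphi_n$ on $\Lambda$ by $\varphi_n=-\alpha$ on $J_0\cap\Lambda$ and $\varphi_n=\alpha\beta_{ni}$ on $J_{n(2^{n-1}+i)}\cap\Lambda$, and $\mathcal{L}_n$ on $\mathcal{V}^b(\Lambda)$ by $(\mathcal{L}_nv)(x)=\sum_{y\in\sigma^{-1}(x)}\varphi_n(y)v(y)$. For $i=1,\dots,2^{n-1}$ let $k_{ni}$ be the function on $\Lambda$ equal to $1$ on $(J_{n(2i-1)}\cup J_{n(2i)})\cap\Lambda$ and $0$ elsewhere; the span of $k_{n1},\dots,k_{n2^{n-1}}$ is invariant under $\mathcal{L}_n$, and $A_n$ denotes the matrix of $\mathcal{L}_n$ on it in this basis. Let $CN_n=\{(x_{n1},\dots,x_{n2^{n-1}})\in\mathbf{R}^{2^{n-1}}: 0\le x_{n1}\le x_{n2}\le\cdots\le x_{n2^{n-1}}\}$. There is a unique direction in the cone $CN_n$ preserved by $A_n$; $v_n=(t_{n1},\dots,t_{n2^{n-1}})\in CN_n$ with $t_{n2^{n-1}}=1$ is the eigenvector of $A_n$ in this direction and $\lambda_n$ is its eigenvalue. The vector $v_n$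 is identified with the function $\sum_i t_{ni}k_{ni}$ on $\Lambda$. *)

theory Defs
  imports "HOL-Analysis.Analysis" "Jordan_Normal_Form.Char_Poly"
begin

text \<open>
  The map \<open>g : I \<rightarrow> I\<close>, \<open>I = [-1,1]\<close>, is a total function \<open>real \<Rightarrow> real\<close> whose values
  outside \<open>I\<close> play no role; derivatives are therefore taken within \<open>I\<close> (one-sided at \<open>\<plusminus>1\<close>).
\<close>

definition deriv_I :: "(real \<Rightarrow> real) \<Rightarrow> real \<Rightarrow> real" where
  "deriv_I g x = vector_derivative g (at x within {-1..1})"

text \<open>Real-analyticity on the closed interval: \<open>g\<close> extends to a complex analytic function on a
  neighbourhood of the interval.\<close>

definition real_analytic_on :: "(real \<Rightarrow> real) \<Rightarrow> real set \<Rightarrow> bool" where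
  "real_analytic_on g S \<longleftrightarrow>
     (\<exists>G. G analytic_on (complex_of_real ` S) \<and>
          (\<forall>x\<in>S. G (complex_of_real x) = complex_of_real (g x)))"

definition feig_alpha :: "(real \<Rightarrow> real) \<Rightarrow> real" where
  "feig_alpha g = - 1 / g 1"

definition feigenbaum_map :: "(real \<Rightarrow> real) \<Rightarrow> bool" where
  "feigenbaum_map g \<longleftrightarrow>
     g ` {-1..1} \<subseteq> {-1..1} \<and>
     real_analytic_on g {-1..1} \<and>
     (\<forall>x\<in>{-1..1}. g (- x) = g x) \<and>
     strict_mono_on {-1..0} g \<and> strict_antimono_on {0..1} g \<and>
     (\<forall>x\<in>{-1..1}. deriv_I g x = 0 \<longleftrightarrow> x = 0) \<and>
     deriv_I (deriv_I g) 0 \<noteq> 0 \<and>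
     g 0 = 1 \<and>
     (g ^^ 3) 0 > - (g ^^ 2) 0 \<and> - (g ^^ 2) 0 > (g ^^ 4) 0 \<and>
     (g ^^ 4) 0 > 0 \<and> 0 > (g ^^ 2) 0 \<and>
     (\<forall>x\<in>{-1..1}. g x = - feig_alpha g * g (g (- x / feig_alpha g)))"

definition crit_orbit :: "(real \<Rightarrow> real) \<Rightarrow> real set" where
  "crit_orbit g = {(g ^^ n) 0 | n. n \<ge> 1}"


subsection \<open>The expanding map and its maximal invariant set\<close>

definition feig_J :: "(real \<Rightarrow> real) \<Rightarrow> real set" where
  "feig_J g = {g 1..1}"

definition feig_J0 :: "(real \<Rightarrow> real) \<Rightarrow> real set" where
  "feig_J0 g = {g 1..(g ^^ 3) 1}"

definition feig_J1 :: "(real \<Rightarrow> real) \<Rightarrow> real set" where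
  "feig_J1 g = {(g ^^ 2) 1..1}"

definition feig_dom :: "(real \<Rightarrow> real) \<Rightarrow> real set" where
  "feig_dom g = feig_J0 g \<union> feig_J1 g"

text \<open>The map \<open>\<sigma>\<close> is only meaningful on \<open>J\<^sub>0 \<union> J\<^sub>1\<close>; all uses below are restricted to this set.\<close>

definition feig_sigma :: "(real \<Rightarrow> real) \<Rightarrow> real \<Rightarrow> real" where
  "feig_sigma g x = (if x \<in> feig_J0 g then - feig_alpha g * x else - feig_alpha g * g x)"

definition feig_phi :: "(real \<Rightarrow> real) \<Rightarrow> real \<Rightarrow> real" where
  "feig_phi g x = vector_derivative (feig_sigma g) (at x within feig_dom g)"

definition feig_Lambda :: "(real \<Rightarrow> real) \<Rightarrow> real set" where
  "feig_Lambda g = {x. \<forall>n. (feig_sigma g ^^ n) x \<in> feig_dom g}"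


subsection \<open>Transfer operators on bounded vector fields\<close>

text \<open>Vector fields on \<open>\<Lambda>\<close> are functions \<open>real \<Rightarrow> real\<close> of which only the values on \<open>\<Lambda>\<close> matter.
  For \<open>x \<in> \<Lambda>\<close> all preimages of \<open>x\<close> in \<open>J\<^sub>0 \<union> J\<^sub>1\<close> again lie in \<open>\<Lambda>\<close>.\<close>

definition bounded_fields :: "(real \<Rightarrow> real) \<Rightarrow> (real \<Rightarrow> real) set" where
  "bounded_fields g = {v. bounded (v ` feig_Lambda g)}"

definition transfer_op ::
    "(real \<Rightarrow> real) \<Rightarrow> (real \<Rightarrow> real) \<Rightarrow> (real \<Rightarrow> real) \<Rightarrow> real \<Rightarrow> real" where
  "transfer_op g w v x = (\<Sum>y | y \<in> feig_dom g \<and> feig_sigma g y = x. w y * v y)"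

definition L_phi_B :: "(real \<Rightarrow> real) \<Rightarrow> (real \<Rightarrow> real) \<Rightarrow> real \<Rightarrow> real" where
  "L_phi_B g = transfer_op g (feig_phi g)"

definition field_eigenvector ::
    "(real \<Rightarrow> real) \<Rightarrow> ((real \<Rightarrow> real) \<Rightarrow> real \<Rightarrow> real) \<Rightarrow> (real \<Rightarrow> real) \<Rightarrow> real \<Rightarrow> bool" where
  "field_eigenvector g L v \<mu> \<longleftrightarrow>
     v \<in> bounded_fields g \<and> (\<exists>x\<in>feig_Lambda g. v x \<noteq> 0) \<and>
     (\<forall>x\<in>feig_Lambda g. L v x = \<mu> * v x)"


subsection \<open>The approximating operators and their matrices\<close>

definition sigma_preimage :: "(real \<Rightarrow> real) \<Rightarrow> nat \<Rightarrow> real set" where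
  "sigma_preimage g n =
     {x. (\<forall>k<n. (feig_sigma g ^^ k) x \<in> feig_dom g) \<and> (feig_sigma g ^^ n) x \<in> feig_J g}"

text \<open>\<open>J\<^sub>n\<^sub>j\<close>, \<open>1 \<le> j \<le> 2\<^sup>n\<close>: the connected component of \<open>\<sigma>\<^sup>-\<^sup>n(J)\<close> with exactly \<open>j - 1\<close> components
  to its left.\<close>

definition J_piece :: "(real \<Rightarrow> real) \<Rightarrow> nat \<Rightarrow> nat \<Rightarrow> real set" where
  "J_piece g n j =
     (THE C. C \<in> components (sigma_preimage g n) \<and>
             card {D \<in> components (sigma_preimage g n). Sup D < Inf C} = j - 1)"

text \<open>\<open>Sup\<close> of the closed interval \<open>[a\<^sub>n\<^sub>i, b\<^sub>n\<^sub>i]\<close> is its right endpoint \<open>b\<^sub>n\<^sub>i\<close>.\<close>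

definition beta :: "(real \<Rightarrow> real) \<Rightarrow> nat \<Rightarrow> nat \<Rightarrow> real" where
  "beta g n i = \<bar>deriv_I g (Sup (J_piece g n (2 ^ (n - 1) + i)))\<bar>"

definition phi_approx :: "(real \<Rightarrow> real) \<Rightarrow> nat \<Rightarrow> real \<Rightarrow> real" where
  "phi_approx g n x =
     - feig_alpha g * indicator (feig_J0 g) x
     + (\<Sum>i = 1..2 ^ (n - 1).
          feig_alpha g * beta g n i * indicator (J_piece g n (2 ^ (n - 1) + i)) x)"

definition L_approx :: "(real \<Rightarrow> real) \<Rightarrow> nat \<Rightarrow> (real \<Rightarrow> real) \<Rightarrow> real \<Rightarrow> real" where
  "L_approx g n = transfer_op g (phi_approx g n)"

definition k_fun :: "(real \<Rightarrow> real) \<Rightarrow> nat \<Rightarrow> nat \<Rightarrow> real \<Rightarrow> real" where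
  "k_fun g n i =
     indicator ((J_piece g n (2 * i - 1) \<union> J_piece g n (2 * i)) \<inter> feig_Lambda g)"

text \<open>Matrix and vector indices start at \<open>0\<close>, so index \<open>i\<close> belongs to \<open>k\<^sub>n\<^sub>,\<^sub>i\<^sub>+\<^sub>1\<close>.\<close>

definition A_mat :: "(real \<Rightarrow> real) \<Rightarrow> nat \<Rightarrow> real mat" where
  "A_mat g n =
     (THE A. A \<in> carrier_mat (2 ^ (n - 1)) (2 ^ (n - 1)) \<and>
        (\<forall>j < 2 ^ (n - 1). \<forall>x\<in>feig_Lambda g.
           L_approx g n (k_fun g n (Suc j)) x =
             (\<Sum>i < 2 ^ (n - 1). A $$ (i, j) * k_fun g n (Suc i) x)))"

definition CN :: "nat \<Rightarrow> real Matrix.vec set" where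
  "CN n = {x \<in> carrier_vec (2 ^ (n - 1)).
             0 \<le> vec_index x 0 \<and>
             (\<forall>i j. i \<le> j \<and> j < 2 ^ (n - 1) \<longrightarrow> vec_index x i \<le> vec_index x j)}"

definition v_vec :: "(real \<Rightarrow> real) \<Rightarrow> nat \<Rightarrow> real Matrix.vec" where
  "v_vec g n =
     (THE t. t \<in> CN n \<and> vec_index t (2 ^ (n - 1) - 1) = 1 \<and>
             (\<exists>\<mu>. eigenvector (A_mat g n) t \<mu>))"

definition lambda_approx :: "(real \<Rightarrow> real) \<Rightarrow> nat \<Rightarrow> real" where
  "lambda_approx g n = (THE \<mu>. eigenvector (A_mat g n) (v_vec g n) \<mu>)"

definition v_fun :: "(real \<Rightarrow> real) \<Rightarrow> nat \<Rightarrow> real \<Rightarrow> real" where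
  "v_fun g n x = (\<Sum>i < 2 ^ (n - 1). vec_index (v_vec g n) i * k_fun g n (Suc i) x)"

end

theory Submission
  imports Defs "HOL-Complex_Analysis.Complex_Analysis"
begin

text \<open>
  Concavity and the functional equation give \<open>g'(1) = - \<alpha>\<close>, \<open>\<bar>\<sigma>'\<bar> \<ge> \<alpha>\<close> and \<open>\<alpha> > 2\<close>. The operator \<open>A\<^sub>n\<close>
  maps the cone of increasing nonnegative vectors into itself and, since \<open>g'\<close> is strictly decreasing,
  is irreducible there, so \<open>v\<^sub>n\<close> and \<open>\<lambda>\<^sub>n\<close> are well defined; comparing last entries yields
  \<open>\<lambda>\<^sub>n = \<alpha>\<^sup>2 - \<alpha> v\<^sub>n(g(1)) \<ge> \<alpha>\<^sup>2 - \<alpha> > 2\<close>. The eigenvalue equation then bounds the oscillation of \<open>v\<^sub>n\<close>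
  on a piece \<open>P\<close> of level \<open>k < n\<close> by \<open>C \<bar>P\<bar>\<close> with \<open>C\<close> independent of \<open>n\<close>. As the critical orbit meets every
  piece, a subsequence converging pointwise on this countable set converges on all of \<open>\<Lambda>\<close>, to a
  continuous function, and the eigenvalue equation passes to the limit; the limit is nonzero because
  \<open>v\<^sub>n(1) = 1\<close>.
\<close>

text \<open>The obstacle is that \<open>v_n\<close> is only a step function, so continuity of the
  limit must come from an estimate uniform in n. A bound C |P| on the oscillation passes from level
  k+1 to level k at the cost of one copy of C per inverse branch, divided by \<lambda>_n; this is
  why an eigenvalue above 2 is wanted. With \<lambda>_n \<ge> \<alpha>^2 - \<alpha> the requirement
  becomes (\<alpha> - 2)(\<alpha> + 1) > 0, and \<alpha> > 2 is obtained without any numerical value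
  of \<alpha>. The variation of g' inside a piece adds only an error proportional to |P|, which the
  surplus \<alpha>^2 - \<alpha> - 2 absorbs into C.

  That the critical orbit meets every piece is the renormalisation equation in disguise: the two
  inverse branches of \<sigma> send g^n(0) to g^(2n)(0) and to g^(2n-1)(0), so the orbit is
  invariant under both.

  Pieces, matrix, eigenvector and eigenvalue are all given by definite descriptions, so each of them
  needs a uniqueness proof before it can be used.\<close>

section \<open>Real analyticity and concavity on the interval\<close>

text \<open>The complex derivative of the extension \<open>G\<close> extends
  \<open>deriv_I f\<close>: on the interval the imaginary part of \<open>G\<close> is constantly
  zero, so its derivative along the interval is real.\<close>

lemma real_analytic_on_imp_deriv:
  assumes "real_analytic_on f {-1..1}"
  shows "real_analytic_on (deriv_I f) {-1..1}"
    and "\<And>x. x \<in> {-1..1} \<Longrightarrow>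
      (f has_real_derivative deriv_I f x) (at x within {-1..1})"
proof -
  obtain G where G: "G analytic_on (complex_of_real ` {-1..1})"
    and Gf: "\<And>x. x \<in> {-1..1} \<Longrightarrow> G (complex_of_real x) = complex_of_real (f x)"
    using assms unfolding real_analytic_on_def by blast
  have key: "(f has_real_derivative deriv_I f x) (at x within {-1..1}) \<and>
             deriv G (complex_of_real x) = complex_of_real (deriv_I f x)"
    if x: "x \<in> {-1..1}" for x
  proof -
    have "(G has_field_derivative deriv G (complex_of_real x)) (at (complex_of_real x))"
      using G x by (simp add: analytic_on_imp_differentiable_at DERIV_deriv_iff_field_differentiable)
    then have vG: "((\<lambda>t. G (complex_of_real t)) has_vector_derivative deriv G (complex_of_real x))
        (at x within {-1..1})"
      by (rule has_vector_derivative_real_field[THEN has_vector_derivative_at_within])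
    have vf: "((\<lambda>t. complex_of_real (f t)) has_vector_derivative deriv G (complex_of_real x))
        (at x within {-1..1})"
      by (rule has_vector_derivative_transform[OF x _ vG]) (simp add: Gf)
    have "((\<lambda>t. Re (complex_of_real (f t))) has_vector_derivative Re (deriv G (complex_of_real x)))
        (at x within {-1..1})"
      by (rule bounded_linear.has_vector_derivative[OF bounded_linear_Re vf])
    then have vr: "(f has_vector_derivative Re (deriv G (complex_of_real x))) (at x within {-1..1})"
      by simp
    have "((\<lambda>t. Im (complex_of_real (f t))) has_vector_derivative Im (deriv G (complex_of_real x)))
        (at x within {-1..1})"
      by (rule bounded_linear.has_vector_derivative[OF bounded_linear_Im vf])
    then have vi: "((\<lambda>t. 0::real) has_vector_derivative Im (deriv G (complex_of_real x))) (at x within {-1..1})"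
      by simp
    have im: "Im (deriv G (complex_of_real x)) = 0"
      using vector_derivative_within_closed_interval[OF _ x vi]
        vector_derivative_within_closed_interval[OF _ x has_vector_derivative_const[of "0::real"]]
      by simp
    have d: "deriv_I f x = Re (deriv G (complex_of_real x))"
      unfolding deriv_I_def by (rule vector_derivative_within_closed_interval[OF _ x vr]) simp
    show ?thesis
      using vr d im by (simp add: has_real_derivative_iff_has_vector_derivative complex_eq_iff)
  qed
  then show "\<And>x. x \<in> {-1..1} \<Longrightarrow>
      (f has_real_derivative deriv_I f x) (at x within {-1..1})"
    by blast
  show "real_analytic_on (deriv_I f) {-1..1}"
    unfolding real_analytic_on_def using analytic_deriv[OF G] key by blast
qed

lemma real_analytic_on_imp_continuous_on:
  assumes "real_analytic_on f {-1..1}"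
  shows "continuous_on {-1..1} f"
  using real_analytic_on_imp_deriv(2)[OF assms]
  by (meson DERIV_continuous continuous_on_eq_continuous_within)

text \<open>Identity theorem. It needs a connected domain, so the neighbourhood on which
  \<open>G\<close> is holomorphic is cut down to its component containing the interval;
  \<open>a\<close> is an accumulation point of the segment where \<open>G\<close> equals
  \<open>c\<close>.\<close>

lemma real_analytic_on_constant_extend:
  assumes f: "real_analytic_on f {-1..1}"
    and ab: "-1 \<le> a" "a < b" "b \<le> 1"
    and c: "\<And>x. x \<in> {a..b} \<Longrightarrow> f x = c"
    and x: "x \<in> {-1..1}"
  shows "f x = c"
proof -
  let ?I = "complex_of_real ` {-1..1}"
  obtain G where G: "G analytic_on ?I"
    and Gf: "\<And>x. x \<in> {-1..1} \<Longrightarrow> G (complex_of_real x) = complex_of_real (f x)"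
    using f unfolding real_analytic_on_def by blast
  obtain T where T: "open T" "?I \<subseteq> T" "G holomorphic_on T"
    using G analytic_on_holomorphic by blast
  define S where "S = connected_component_set T 0"
  have conI: "connected ?I"
    by (intro connected_continuous_image continuous_intros connected_Icc)
  have "0 \<in> ?I" by force
  then have IS: "?I \<subseteq> S"
    unfolding S_def by (intro connected_component_maximal conI T)
  have S: "open S" "connected S" "G holomorphic_on S"
    using T holomorphic_on_subset[OF T(3) connected_component_subset]
    by (auto simp: S_def open_connected_component)
  let ?U = "complex_of_real ` {a..b}"
  have US: "?U \<subseteq> S" using IS ab by force
  have lim: "complex_of_real a islimpt ?U"
  proof -
    have "connected ?U"
      by (intro connected_continuous_image continuous_intros connected_Icc)
    moreover have "a \<in> {a..b}" "b \<in> {a..b}" using ab by auto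
    then have "complex_of_real a \<in> ?U" "complex_of_real b \<in> ?U" by blast+
    ultimately show ?thesis
      using connected_imp_perfect ab by (metis of_real_eq_iff order_less_irrefl singletonD)
  qed
  have "G (complex_of_real x) - complex_of_real c = 0"
  proof (rule analytic_continuation[where f = "\<lambda>z. G z - complex_of_real c", OF _ S(1,2) US _ lim])
    show "(\<lambda>z. G z - complex_of_real c) holomorphic_on S" by (intro holomorphic_intros S)
    show "complex_of_real a \<in> S" using US ab by auto
    show "G z - complex_of_real c = 0" if "z \<in> ?U" for z
      using that ab by (auto simp: Gf c)
    show "complex_of_real x \<in> S" using IS x by blast
  qed
  then show ?thesis using Gf[OF x] by simp
qed

text \<open>Along the segment from \<open>x\<close> to \<open>y\<close>, concavity keeps the
  difference quotient above the slope of the chord, and the quotient tends to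
  \<open>d * (y - x)\<close>. Only the derivative within \<open>S\<close> enters, so
  \<open>x\<close> may be an endpoint, as is needed at 1.\<close>

lemma concave_on_tangent:
  fixes f :: "real \<Rightarrow> real"
  assumes conc: "concave_on S f" and x: "x \<in> S" and y: "y \<in> S"
    and f': "(f has_real_derivative d) (at x within S)"
  shows "f y \<le> f x + d * (y - x)"
proof -
  let ?l = "\<lambda>t. x + t * (y - x)"
  have conv: "convex S" using conc by (simp add: concave_on_imp_convex)
  have eq: "?l t = (1 - t) * x + t * y" for t by (simp add: algebra_simps)
  have sub: "?l ` {0..1} \<subseteq> S"
    using convexD[OF conv x y] by (auto simp: eq)
  have "(?l has_real_derivative (y - x)) (at 0 within {0..1})"
    by (auto intro!: derivative_eq_intros)
  moreover have "(f has_real_derivative d) (at (?l 0) within ?l ` {0..1})"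
    using has_field_derivative_subset[OF f' sub] by simp
  ultimately have "((f \<circ> ?l) has_real_derivative d * (y - x)) (at 0 within {0..1})"
    by (rule DERIV_image_chain[rotated])
  then have lim: "((\<lambda>t. (f (?l t) - f x) / t) \<longlongrightarrow> d * (y - x)) (at 0 within {0..1})"
    by (simp add: has_field_derivative_iff)
  have "f y - f x \<le> d * (y - x)"
  proof (rule tendsto_lowerbound[OF lim])
    show "\<forall>\<^sub>F t in at 0 within {0..1}. f y - f x \<le> (f (?l t) - f x) / t"
      unfolding eventually_at
    proof (intro exI[of _ 1] conjI ballI impI)
      fix t :: real assume t: "t \<in> {0..1}" "t \<noteq> 0 \<and> dist t 0 < 1"
      have "(1 - t) * f x + t * f y \<le> f (?l t)"
        using concave_onD[OF conc, of t x y] t x y by (simp add: eq)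
      then have "t * (f y - f x) \<le> f (?l t) - f x" by (simp add: algebra_simps)
      then show "f y - f x \<le> (f (?l t) - f x) / t"
        using t by (simp add: pos_le_divide_eq mult.commute)
    qed simp
    show "at 0 within {0..1::real} \<noteq> bot"
      by (simp add: trivial_limit_within islimpt_Icc)
  qed
  then show ?thesis by simp
qed


lemma has_real_derivative_transform_on:
  assumes "x \<in> S" "\<And>y. y \<in> S \<Longrightarrow> h y = f y" "(f has_real_derivative d) (at x within S)"
  shows "(h has_real_derivative d) (at x within S)"
  using assms unfolding has_real_derivative_iff_has_vector_derivative
  by (rule has_vector_derivative_transform)

section \<open>The constants and intervals of the Feigenbaum map\<close>

locale concave_feigenbaum =
  fixes g :: "real \<Rightarrow> real"
  assumes feig: "feigenbaum_map g"
    and conc: "concave_on {-1..1} g"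
begin

abbreviation al :: real where "al \<equiv> feig_alpha g"

abbreviation g' :: "real \<Rightarrow> real" where "g' \<equiv> deriv_I g"

lemma g_analytic: "real_analytic_on g {-1..1}"
  using feig unfolding feigenbaum_map_def by blast

lemma g_maps: "x \<in> {-1..1} \<Longrightarrow> g x \<in> {-1..1}"
  using feig unfolding feigenbaum_map_def by blast

lemma g_even: "x \<in> {-1..1} \<Longrightarrow> g (- x) = g x"
  using feig unfolding feigenbaum_map_def by blast

lemma g_0: "g 0 = 1"
  using feig unfolding feigenbaum_map_def by blast

lemma g_decreasing: "0 \<le> x \<Longrightarrow> x < y \<Longrightarrow> y \<le> 1 \<Longrightarrow> g y < g x"
proof -
  have "strict_antimono_on {0..1} g" using feig unfolding feigenbaum_map_def by blast
  then show "0 \<le> x \<Longrightarrow> x < y \<Longrightarrow> y \<le> 1 \<Longrightarrow> g y < g x" by (simp add: monotone_on_def)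
qed

lemma g_critical: "x \<in> {-1..1} \<Longrightarrow> g' x = 0 \<longleftrightarrow> x = 0"
  using feig unfolding feigenbaum_map_def by blast

lemma g_fixed_point: "x \<in> {-1..1} \<Longrightarrow> g x = - al * g (g (- x / al))"
  using feig unfolding feigenbaum_map_def by blast

lemma g_nondegenerate: "deriv_I g' 0 \<noteq> 0"
  using feig unfolding feigenbaum_map_def by blast

lemma critical_values:
  "g (g 1) > - g 1" "- g 1 > g (g (g 1))" "g (g (g 1)) > 0" "g 1 < 0"
proof -
  have "(g ^^ 2) 0 = g 1" "(g ^^ 3) 0 = g (g 1)" "(g ^^ 4) 0 = g (g (g 1))"
    by (simp_all add: g_0 eval_nat_numeral)
  moreover have "(g ^^ 3) 0 > - (g ^^ 2) 0" "- (g ^^ 2) 0 > (g ^^ 4) 0"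
    "(g ^^ 4) 0 > 0" "0 > (g ^^ 2) 0"
    using feig unfolding feigenbaum_map_def by blast+
  ultimately show "g (g 1) > - g 1" "- g 1 > g (g (g 1))" "g (g (g 1)) > 0" "g 1 < 0"
    by simp_all
qed

lemma al_gt_1: "al > 1"
proof -
  have "g (g 1) \<le> 1" using g_maps[OF g_maps[of 1]] by simp
  then have "- g 1 < 1" using critical_values(1) by linarith
  then have "1 < inverse (- g 1)"
    using critical_values(4) by (intro one_less_inverse) linarith+
  then show ?thesis unfolding feig_alpha_def by (simp add: inverse_eq_divide)
qed

lemma al_pos: "al > 0" and al_nz: "al \<noteq> 0"
  using al_gt_1 by linarith+

lemma inv_al_pos: "0 < 1 / al" and inv_al_less_1: "1 / al < 1"
  using al_gt_1 by (simp_all only: zero_less_divide_1_iff divide_less_eq_1_pos al_pos)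

lemma inv_al_mem: "1 / al \<in> {-1..1}" "1 / al \<in> {0<..<1}"
  using inv_al_pos inv_al_less_1 by (simp_all only: atLeastAtMost_iff greaterThanLessThan_iff) linarith+

lemma g_1: "g 1 = - 1 / al"
  using critical_values(4) by (simp add: feig_alpha_def)

lemma g_g_1: "g (g 1) = g (1 / al)"
  using g_even[OF inv_al_mem(1)] by (simp add: g_1)

lemma g_g_inv_al: "g (g (1 / al)) = 1 / al\<^sup>2"
proof -
  have "- 1 / al = - al * g (g (1 / al))"
    using g_fixed_point[of 1] g_even[OF inv_al_mem(1)] by (simp add: g_1)
  then show ?thesis using al_nz by (simp add: field_simps power2_eq_square)
qed

lemma g_inv_al_bounds: "1 / al < g (1 / al)" "g (1 / al) < 1"
  using critical_values(1) g_decreasing[of 0 "1 / al"] inv_al_mem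
  by (simp_all add: g_1 g_g_1 g_0 g_even)

lemma inv_al_sq_less: "1 / al\<^sup>2 < 1 / al"
  using al_gt_1 by (simp add: field_simps power2_eq_square)

lemma feig_J_eq: "feig_J g = {- 1 / al..1}"
  and feig_J0_eq: "feig_J0 g = {- 1 / al..1 / al\<^sup>2}"
  and feig_J1_eq: "feig_J1 g = {g (1 / al)..1}"
proof -
  have "(g ^^ 3) 1 = 1 / al\<^sup>2" "(g ^^ 2) 1 = g (1 / al)"
    by (simp_all add: eval_nat_numeral) (simp_all add: g_g_1 g_g_inv_al power2_eq_square)
  then show "feig_J g = {- 1 / al..1}" "feig_J0 g = {- 1 / al..1 / al\<^sup>2}"
    "feig_J1 g = {g (1 / al)..1}"
    by (simp_all add: feig_J_def feig_J0_def feig_J1_def g_1)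
qed

lemma J0_subset_J: "feig_J0 g \<subseteq> feig_J g" and J1_subset_J: "feig_J1 g \<subseteq> feig_J g"
  and J_subset: "feig_J g \<subseteq> {-1..1}" and J1_pos: "x \<in> feig_J1 g \<Longrightarrow> 0 < x"
  and J1_subset: "feig_J1 g \<subseteq> {0..1}"
proof -
  define s q where "s = 1 / al" and "q = 1 / al\<^sup>2"
  have "0 < s" "s < 1" "0 < q" "q < s" "s < g s" "g s < 1"
    using inv_al_mem(2) inv_al_sq_less g_inv_al_bounds al_gt_1
    unfolding s_def q_def greaterThanLessThan_iff by simp_all
  moreover have "feig_J g = {- s..1}" "feig_J0 g = {- s..q}" "feig_J1 g = {g s..1}"
    by (simp_all add: feig_J_eq feig_J0_eq feig_J1_eq s_def q_def)
  ultimately show "feig_J0 g \<subseteq> feig_J g" "feig_J1 g \<subseteq> feig_J g"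
    "feig_J g \<subseteq> {-1..1}" "x \<in> feig_J1 g \<Longrightarrow> 0 < x" "feig_J1 g \<subseteq> {0..1}"
    by auto
qed

lemma J0_less_J1: "x \<in> feig_J0 g \<Longrightarrow> y \<in> feig_J1 g \<Longrightarrow> x < y"
  using inv_al_sq_less g_inv_al_bounds by (auto simp: feig_J0_eq feig_J1_eq)

lemma dom_subset_J: "feig_dom g \<subseteq> feig_J g"
  using J0_subset_J J1_subset_J by (auto simp: feig_dom_def)

lemma sigma_J0: "x \<in> feig_J0 g \<Longrightarrow> feig_sigma g x = - al * x"
  by (simp add: feig_sigma_def)

lemma sigma_J1: "x \<in> feig_J1 g \<Longrightarrow> feig_sigma g x = - al * g x"
  using J0_less_J1[of x x] by (auto simp add: feig_sigma_def)


subsection \<open>Derivative bounds\<close>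

lemma g_deriv: "x \<in> {-1..1} \<Longrightarrow> (g has_real_derivative g' x) (at x within {-1..1})"
  using real_analytic_on_imp_deriv(2)[OF g_analytic] .

lemma g'_analytic: "real_analytic_on g' {-1..1}"
  using real_analytic_on_imp_deriv(1)[OF g_analytic] .

lemma g'_deriv: "x \<in> {-1..1} \<Longrightarrow> (g' has_real_derivative deriv_I g' x) (at x within {-1..1})"
  using real_analytic_on_imp_deriv(2)[OF g'_analytic] .

lemma g_cont: "continuous_on {-1..1} g"
  using real_analytic_on_imp_continuous_on[OF g_analytic] .

lemma DERIV_I_unique:
  assumes "(f has_real_derivative a) (at x within {-1..1})"
    "(f has_real_derivative b) (at x within {-1..1})" "x \<in> {-1..1}"
  shows "a = b"
  using vector_derivative_within_closed_interval[OF _ assms(3)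
      assms(1)[unfolded has_real_derivative_iff_has_vector_derivative]]
    vector_derivative_within_closed_interval[OF _ assms(3)
      assms(2)[unfolded has_real_derivative_iff_has_vector_derivative]]
  by simp

lemma scaled_mem:
  assumes "x \<in> {-1..1}"
  shows "- x / al \<in> {-1..1}"
proof -
  have "\<bar>- x / al\<bar> = \<bar>x\<bar> / al" using al_pos by simp
  also have "\<dots> \<le> 1" using assms al_gt_1 by (subst pos_divide_le_eq) auto
  finally show ?thesis unfolding abs_le_iff by simp
qed

lemma g_scaled_image: "(g \<circ> (\<lambda>x. - x / al)) ` {-1..1} \<subseteq> {-1..1}"
proof (rule image_subsetI)
  fix x :: real assume "x \<in> {-1..1}"
  then show "(g \<circ> (\<lambda>x. - x / al)) x \<in> {-1..1}"
    unfolding o_apply by (intro g_maps scaled_mem)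
qed

lemma g'_odd:
  assumes x: "x \<in> {-1..1}"
  shows "g' (- x) = - g' x"
proof -
  have "(uminus has_real_derivative - 1) (at x within {-1..1})"
    using al_nz by (auto intro!: derivative_eq_intros)
  moreover have "(g has_real_derivative g' (- x)) (at (- x) within uminus ` {-1..1})"
    using g_deriv[of "- x"] x by simp
  ultimately have "((g \<circ> uminus) has_real_derivative g' (- x) * - 1) (at x within {-1..1})"
    by (rule DERIV_image_chain[rotated])
  then have "(g has_real_derivative g' (- x) * - 1) (at x within {-1..1})"
    by (rule has_real_derivative_transform_on[OF x, rotated]) (simp add: g_even)
  from DERIV_I_unique[OF this g_deriv[OF x] x] show ?thesis by simp
qed

text \<open>The inner factor -1/\<alpha> cancels the outer factor -\<alpha>, so the differentiated
  equation is purely multiplicative.\<close>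

lemma g'_fixed_point:
  assumes x: "x \<in> {-1..1}"
  shows "g' x = g' (g (- x / al)) * g' (- x / al)"
proof -
  let ?h = "\<lambda>x. - x / al"
  have "(?h has_real_derivative - 1 / al) (at x within {-1..1})"
    using al_nz by (auto intro!: derivative_eq_intros)
  moreover have h: "?h ` {-1..1} \<subseteq> {-1..1}" using scaled_mem by blast
  then have "(g has_real_derivative g' (?h x)) (at (?h x) within ?h ` {-1..1})"
    using has_field_derivative_subset[OF g_deriv[OF scaled_mem[OF x]]] by blast
  ultimately have 1: "((g \<circ> ?h) has_real_derivative g' (?h x) * (- 1 / al)) (at x within {-1..1})"
    by (rule DERIV_image_chain[rotated])
  have "(g \<circ> ?h) ` {-1..1} \<subseteq> {-1..1}" by (rule g_scaled_image)
  then have "(g has_real_derivative g' (g (?h x))) (at ((g \<circ> ?h) x) within (g \<circ> ?h) ` {-1..1})"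
    using has_field_derivative_subset[OF g_deriv[OF g_maps[OF scaled_mem[OF x]]]] by simp
  from DERIV_image_chain[OF this 1]
  have "((\<lambda>x. - al * (g \<circ> (g \<circ> ?h)) x) has_real_derivative
      - al * (g' (g (?h x)) * (g' (?h x) * (- 1 / al)))) (at x within {-1..1})"
    by (rule DERIV_cmult)
  then have "(g has_real_derivative - al * (g' (g (?h x)) * (g' (?h x) * (- 1 / al)))) (at x within {-1..1})"
    by (rule has_real_derivative_transform_on[OF x, rotated]) (simp only: o_apply, erule g_fixed_point)
  from DERIV_I_unique[OF this g_deriv[OF x] x] show ?thesis using al_nz by simp
qed

text \<open>The value \<open>g'(1)\<close> results from differentiating the functional equation twice at \<open>0\<close>.\<close>

lemma g'_1: "g' 1 = - al"
proof -
  let ?h = "\<lambda>x. - x / al" and ?I = "{-1..1::real}"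
  have 0: "(0::real) \<in> ?I" by simp
  have h: "?h ` ?I \<subseteq> ?I" using scaled_mem by blast
  have dh: "(?h has_real_derivative - 1 / al) (at 0 within ?I)"
    using al_nz by (auto intro!: derivative_eq_intros)
  have "(g has_real_derivative g' (?h 0)) (at (?h 0) within ?h ` ?I)"
    using has_field_derivative_subset[OF g_deriv[OF scaled_mem[OF 0]] h] .
  from DERIV_image_chain[OF this dh]
  have 1: "((g \<circ> ?h) has_real_derivative 0) (at 0 within ?I)"
    using g_critical[of 0] by simp
  have "(g \<circ> ?h) ` ?I \<subseteq> ?I" by (rule g_scaled_image)
  then have "(g' has_real_derivative deriv_I g' 1) (at ((g \<circ> ?h) 0) within (g \<circ> ?h) ` ?I)"
    using has_field_derivative_subset[OF g'_deriv[of 1]] by (simp add: g_0)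
  from DERIV_image_chain[OF this 1]
  have 2: "((g' \<circ> (g \<circ> ?h)) has_real_derivative 0) (at 0 within ?I)" by simp
  have "(g' has_real_derivative deriv_I g' 0) (at (?h 0) within ?h ` ?I)"
    using has_field_derivative_subset[OF g'_deriv[OF 0] h] by simp
  from DERIV_image_chain[OF this dh]
  have "((g' \<circ> ?h) has_real_derivative deriv_I g' 0 * (- 1 / al)) (at 0 within ?I)" .
  \<comment> \<open>The first factor has derivative 0, since g'(0) = 0 kills the inner derivative.
    Only the derivative of the second factor survives, and comparison with the left-hand side gives
    g''(0) = -g'(1) g''(0) / \<alpha>.\<close>
  from DERIV_mult[OF 2 this]
  have "((\<lambda>x. (g' \<circ> (g \<circ> ?h)) x * (g' \<circ> ?h) x) has_real_derivative
      g' 1 * (deriv_I g' 0 * (- 1 / al))) (at 0 within ?I)"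
    by (simp add: g_0 mult.commute)
  then have "(g' has_real_derivative g' 1 * (deriv_I g' 0 * (- 1 / al))) (at 0 within ?I)"
    by (rule has_real_derivative_transform_on[OF 0, rotated]) (simp only: o_apply, erule g'_fixed_point)
  from DERIV_I_unique[OF this g'_deriv[OF 0] 0]
  have "(- g' 1 / al) * deriv_I g' 0 = 1 * deriv_I g' 0" by simp
  then have "- g' 1 / al = 1" using g_nondegenerate by (simp only: mult_right_cancel simp_thms)
  then show ?thesis using al_nz unfolding divide_eq_1_iff by simp
qed

lemma g_tangent: "x \<in> {-1..1} \<Longrightarrow> y \<in> {-1..1} \<Longrightarrow> g y \<le> g x + g' x * (y - x)"
  by (rule concave_on_tangent[OF conc _ _ g_deriv])

text \<open>Sum of the tangent inequality at \<open>x\<close>, evaluated at \<open>y\<close>, and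
  the one at \<open>y\<close>, evaluated at \<open>x\<close>.\<close>

lemma g'_antimono:
  assumes "-1 \<le> x" "x \<le> y" "y \<le> 1"
  shows "g' y \<le> g' x"
proof (cases "x = y")
  case False
  have "g y \<le> g x + g' x * (y - x)" "g x \<le> g y + g' y * (x - y)"
    using g_tangent assms by auto
  then have "g' y * (y - x) \<le> g' x * (y - x)" by (simp add: algebra_simps)
  then show ?thesis using False assms by simp
qed simp

text \<open>If \<open>g'\<close> took the same value twice, it would be constant by analyticity.\<close>

lemma g'_strict_antimono:
  assumes "-1 \<le> x" "x < y" "y \<le> 1"
  shows "g' y < g' x"
proof (rule ccontr)
  assume "\<not> g' y < g' x"
  then have eq: "g' y = g' x" using g'_antimono[of x y] assms by simp
  have "g' z = g' x" if "z \<in> {x..y}" for z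
    using g'_antimono[of x z] g'_antimono[of z y] that assms eq by simp
  from real_analytic_on_constant_extend[OF g'_analytic assms this]
  have "g' 1 = g' 0" by simp
  then show False using g_critical[of 0] g_critical[of 1] by simp
qed

lemma g'_nonpos: "0 \<le> x \<Longrightarrow> x \<le> 1 \<Longrightarrow> g' x \<le> 0"
  using g'_antimono[of 0 x] g_critical[of 0] by simp

lemma g'_product: "g' (g (1 / al)) * g' (1 / al) = al"
  using g'_fixed_point[of 1] g'_1 g_even[OF inv_al_mem(1)] g'_odd[OF inv_al_mem(1)] by simp

lemma g'_inv_al_neg: "g' (1 / al) < 0"
proof -
  have "g' (1 / al) \<noteq> 0" using g'_product al_pos by auto
  then show ?thesis using g'_nonpos[of "1 / al"] inv_al_mem by simp
qed

text \<open>In \<open>g'_product\<close> the factor g'(1/\<alpha>) has absolute value below |g'(1)|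
  = \<alpha>, so the other factor, at the left end of \<open>feig_J1 g\<close>, must exceed 1 in
  absolute value; monotonicity of g' carries this to the whole interval.\<close>

lemma g'_J1_less:
  assumes "x \<in> feig_J1 g"
  shows "g' x < - 1"
proof -
  have "- al < g' (1 / al)"
    using g'_strict_antimono[of "1 / al" 1] inv_al_less_1 inv_al_pos unfolding g'_1 by linarith
  then have "g' (g (1 / al)) * g' (1 / al) > - 1 * g' (1 / al)"
    using g'_product by simp
  then have c: "g' (g (1 / al)) < - 1"
    using g'_inv_al_neg unfolding mult_less_cancel_right by linarith
  have x: "g (1 / al) \<le> x" "x \<le> 1" using assms unfolding feig_J1_eq by simp_all
  have "- 1 \<le> g (1 / al)" using g_maps[OF inv_al_mem(1)] by simp
  from g'_antimono[OF this x] c show ?thesis by linarith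
qed

text \<open>With \<open>s = 1/\<alpha>\<close> and \<open>u = 1 - g(s)\<close>, the tangents of \<open>g\<close> at \<open>1\<close>, at \<open>s\<close> and at \<open>g(s)\<close> give
  \<open>u \<ge> s\<^sup>2 + s\<^sup>3\<close>, \<open>-g'(s) \<ge> \<alpha>u\<close> and \<open>u (1 - u - s\<^sup>2) \<le> 1 - u - s\<close>, which is impossible for \<open>s \<ge> 1/2\<close>.\<close>

lemma al_gt_2: "al > 2"
proof (rule ccontr)
  assume "\<not> al > 2"
  define s u d e where "s = 1 / al" and "u = 1 - g s" and "d = - g' s" and "e = - g' (g s)"
  have s: "1/2 \<le> s" "s < 1" "s * al = 1"
    using \<open>\<not> al > 2\<close> al_gt_1 unfolding s_def by (simp_all add: field_simps)
  have gs: "s < g s" "g s < 1" using g_inv_al_bounds unfolding s_def by blast+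
  have gsu: "g s = 1 - u" by (simp add: u_def)
  have de: "d * e = al" using g'_product by (simp add: d_def e_def s_def mult.commute)
  have d: "d > 0" using g'_inv_al_neg by (simp add: d_def s_def)
  have "0 < d * e" using de al_pos by simp
  then have e: "e > 0" using d by (rule zero_less_mult_pos)
  have ggs: "g (g s) = s\<^sup>2" using g_g_inv_al by (simp add: s_def power_divide)
  have g1: "g 1 = - s" by (simp add: s_def g_1)
  have t1: "s\<^sup>2 \<le> - s + al * u"
    using g_tangent[of 1 "g s"] gs s ggs g1 g'_1 by (simp add: u_def algebra_simps)
  have t2: "u \<le> s * d"
    using g_tangent[of s 0] s by (simp add: g_0 u_def d_def algebra_simps)
  have t3: "g s - s\<^sup>2 \<le> e * (g s - s)"
    using g_tangent[of "g s" s] gs s ggs by (simp add: e_def algebra_simps)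
  have "s * s\<^sup>2 \<le> s * (- s + al * u)" by (rule mult_left_mono[OF t1]) (use s in linarith)
  also have "\<dots> = (s * al) * u - s\<^sup>2" by (simp add: power2_eq_square right_diff_distrib')
  finally have u1: "s * s\<^sup>2 + s\<^sup>2 \<le> u" unfolding s(3) by linarith
  have s2: "1/4 \<le> s\<^sup>2"
    using mult_mono[of "1/2" s "1/2" s] s(1) unfolding power2_eq_square by simp
  have "1/2 * (1/4) \<le> s * s\<^sup>2" by (rule mult_mono) (use s(1) s2 in linarith)+
  then have u: "3/8 \<le> u" using u1 s2 by linarith
  \<comment> \<open>Since \<open>d * e = al\<close> and \<open>s * al = 1\<close>, the unknown
    slopes cancel. The result eliminates \<open>e\<close> from \<open>t3\<close>.\<close>
  have "u * e \<le> s * d * e" by (rule mult_right_mono[OF t2]) (use e in linarith)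
  then have ue: "u * e \<le> 1" unfolding mult.assoc de s(3) .
  have gs': "0 \<le> g s - s" using gs(1) by linarith
  have "u * (g s - s\<^sup>2) \<le> u * (e * (g s - s))"
    by (rule mult_left_mono[OF t3]) (use u in linarith)
  also have "\<dots> = (u * e) * (g s - s)" by (rule mult.assoc[symmetric])
  also have "\<dots> \<le> 1 * (g s - s)" by (rule mult_right_mono[OF ue gs'])
  finally have "u * (1 - u - s\<^sup>2) \<le> 1 - u - s" unfolding gsu by simp
  \<comment> \<open>In this arrangement one side increases and the other decreases with
    \<open>u\<close>, so \<open>u\<close> may be replaced by its lower bound 3/8.\<close>
  moreover have "(1 - u) * (1 - u - s) - u * (s * (1 - s)) = (1 - u - s) - u * (1 - u - s\<^sup>2)"
    by (simp add: algebra_simps power2_eq_square)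
  ultimately have 1: "u * (s * (1 - s)) \<le> (1 - u) * (1 - u - s)" by linarith
  have us: "0 \<le> 1 - u - s" using gs' unfolding gsu .
  have 2: "(1 - u) * (1 - u - s) \<le> 5/8 * (5/8 - s)"
    by (rule mult_mono) (use u us s(1) in linarith)+
  have 3: "3/8 * (s * (1 - s)) \<le> u * (s * (1 - s))"
    by (rule mult_right_mono[OF u]) (use s in simp)
  \<comment> \<open>As 1/2 \<le> s \<le> 1 - u \<le> 5/8, this bounds the quadratic s(1 - s) below
    by a linear function; the final inequality then forces s \<le> 35/74, below 1/2.\<close>
  have "0 \<le> (s - 1/2) * (5/8 - s)"
    by (rule mult_nonneg_nonneg) (use s(1) u us in linarith)+
  moreover have "(s - 1/2) * (5/8 - s) = s * (1 - s) + s / 8 - 5/16" by (simp add: field_simps)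
  ultimately have "5/16 \<le> s * (1 - s) + s / 8" by linarith
  moreover have "3/8 * (s * (1 - s)) \<le> 5/8 * (5/8 - s)" by (rule order_trans[OF 3 order_trans[OF 1 2]])
  ultimately show False using s(1) by argo
qed

text \<open>The second derivative is again real analytic, hence bounded. The constant controls how
  much the weights vary inside a piece in \<open>vf_oscillation\<close>.\<close>

lemma g'_Lipschitz:
  obtains K where "K \<ge> 0"
    and "\<And>x y. x \<in> {-1..1} \<Longrightarrow> y \<in> {-1..1} \<Longrightarrow> \<bar>g' x - g' y\<bar> \<le> K * \<bar>x - y\<bar>"
proof -
  have "continuous_on {-1..1} (deriv_I g')"
    using real_analytic_on_imp_continuous_on real_analytic_on_imp_deriv(1) g'_analytic by blast
  then have "bounded (deriv_I g' ` {-1..1})"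
    by (intro compact_imp_bounded compact_continuous_image) auto
  then obtain K where K: "\<And>x. x \<in> {-1..1} \<Longrightarrow> norm (deriv_I g' x) \<le> K"
    unfolding bounded_iff by blast
  have "norm (g' x - g' y) \<le> K * norm (x - y)" if "x \<in> {-1..1}" "y \<in> {-1..1}" for x y
    by (rule field_differentiable_bound[OF convex_real_interval(5) g'_deriv K that])
  moreover have "K \<ge> 0" using order_trans[OF norm_ge_zero K[of 0]] by simp
  ultimately show ?thesis using that[of K] by simp
qed

end


section \<open>Perron-Frobenius theory on the cone of increasing vectors\<close>

definition inc :: "(nat \<Rightarrow> real) \<Rightarrow> nat \<Rightarrow> real" where
  "inc t i = (case i of 0 \<Rightarrow> t 0 | Suc j \<Rightarrow> t (Suc j) - t j)"

lemma inc_simps [simp]: "inc t 0 = t 0" "inc t (Suc j) = t (Suc j) - t j"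
  by (simp_all add: inc_def)

lemma inc_linear: "inc (\<lambda>i. x i - k * y i) i = inc x i - k * inc y i"
  by (cases i) (simp_all add: algebra_simps)

lemma inc_add: "inc (\<lambda>i. x i + y i) i = inc x i + inc y i"
  by (cases i) simp_all

lemma inc_scale: "inc (\<lambda>i. k * y i) i = k * inc y i"
  by (cases i) (simp_all add: algebra_simps)

lemma inc_cong: "(\<And>j. j < N \<Longrightarrow> x j = y j) \<Longrightarrow> i < N \<Longrightarrow> inc x i = inc y i"
  by (cases i) simp_all

lemma sum_inc: "(\<Sum>i\<le>j. inc t i) = t j"
  by (induction j) simp_all

lemma inc_nonneg_mono:
  assumes "\<And>i. i < N \<Longrightarrow> 0 \<le> inc t i" "i \<le> j" "j < N"
  shows "t i \<le> t j"
proof -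
  have "(\<Sum>k\<le>i. inc t k) \<le> (\<Sum>k\<le>j. inc t k)"
    using assms by (intro sum_mono2) auto
  then show ?thesis by (simp add: sum_inc)
qed

lemma inc_le:
  assumes "\<And>i. i < N \<Longrightarrow> 0 \<le> inc t i" "i \<le> j" "j < N"
  shows "inc t i \<le> t j"
proof -
  have "inc t i \<le> (\<Sum>k\<le>j. inc t k)"
    using assms by (intro member_le_sum) auto
  then show ?thesis by (simp add: sum_inc)
qed

lemma tendsto_inc:
  assumes "\<And>i. (\<lambda>n. f n i) \<longlonglongrightarrow> t i"
  shows "(\<lambda>n. inc (f n) i) \<longlonglongrightarrow> inc t i"
  using assms by (cases i) (auto intro: tendsto_diff)

lemma inc_eq_0D:
  assumes "\<And>i. i < N \<Longrightarrow> inc t i = 0" "i < N"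
  shows "t i = 0"
  using assms sum_inc[of t i] by (metis atMost_iff order_le_less_trans sum.neutral)

text \<open>In the coordinates \<open>inc t\<close>, in which the cone is the nonnegative orthant, the operator \<open>T\<close> is a
  nonnegative irreducible matrix, so existence and uniqueness of its eigenvector in the cone
  follow as in Perron-Frobenius theory.\<close>

locale cone_operator =
  fixes N :: nat and a :: real and c :: "nat \<Rightarrow> real"
  assumes N: "N > 0" and a: "a > 0" and c0: "a < c 0"
    and c_mono: "\<And>i. Suc i < N \<Longrightarrow> c i < c (Suc i)"
begin

text \<open>The action of \<open>A_n\<close> on coordinates, for N = 2^(n-1). The inverse branches
  send piece \<open>i\<close> of level n-1 to the pieces \<open>N - 1 - i\<close> and
  \<open>N + i\<close> of level n, and halving an index gives the parent piece at level n-1.\<close>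

definition T :: "(nat \<Rightarrow> real) \<Rightarrow> nat \<Rightarrow> real" where
  "T t i = - a * t ((N - 1 - i) div 2) + c i * t ((N + i) div 2)"

text \<open>Adding the identity keeps increments positive once they are positive, so that powers of
  \<open>F\<close> can spread positivity to all coordinates.\<close>

definition F :: "(nat \<Rightarrow> real) \<Rightarrow> nat \<Rightarrow> real" where
  "F t i = t i + T t i"

definition mono_cone :: "(nat \<Rightarrow> real) set" where
  "mono_cone = {t. \<forall>i<N. 0 \<le> inc t i}"

lemma coneD: "t \<in> mono_cone \<Longrightarrow> i < N \<Longrightarrow> 0 \<le> inc t i"
  by (simp add: mono_cone_def)

lemma cone_mono: "t \<in> mono_cone \<Longrightarrow> i \<le> j \<Longrightarrow> j < N \<Longrightarrow> t i \<le> t j"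
  by (rule inc_nonneg_mono) (auto simp: coneD)

lemma cone_nonneg: "t \<in> mono_cone \<Longrightarrow> i < N \<Longrightarrow> 0 \<le> t i"
  using cone_mono[of t 0 i] coneD[of t 0] by simp

lemma c_pos: "i < N \<Longrightarrow> 0 < c i"
proof (induction i)
  case 0 then show ?case using a c0 by simp
next
  case (Suc i) then show ?case using c_mono[of i] by simp
qed

text \<open>Both differences of \<open>t\<close> in the increment contribute with a nonnegative
  sign: the index next to \<open>- a\<close> falls as \<open>i\<close> grows, while the one next to
  \<open>c i\<close> rises. Dropping them leaves the gap between consecutive weights times one value
  of \<open>t\<close>.\<close>

lemma inc_T_ge:
  assumes t: "t \<in> mono_cone" and i: "i < N"
  shows "(case i of 0 \<Rightarrow> c 0 - a | Suc j \<Rightarrow> c (Suc j) - c j) * t ((N + i) div 2) \<le> inc (T t) i"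
proof (cases i)
  case 0
  have "t ((N - 1) div 2) \<le> t (N div 2)" using t N by (intro cone_mono) auto
  then have "a * t ((N - 1) div 2) \<le> a * t (N div 2)" using a by simp
  then show ?thesis using 0 by (simp add: T_def algebra_simps)
next
  case (Suc j)
  have "t ((N - 1 - Suc j) div 2) \<le> t ((N - 1 - j) div 2)" using t N i Suc
    by (intro cone_mono) (auto intro: div_le_mono)
  then have 1: "a * t ((N - 1 - Suc j) div 2) \<le> a * t ((N - 1 - j) div 2)" using a by simp
  have "t ((N + j) div 2) \<le> t ((N + Suc j) div 2)" using t N i Suc
    by (intro cone_mono) (auto intro: div_le_mono)
  then have "c j * t ((N + j) div 2) \<le> c j * t ((N + Suc j) div 2)"
    using c_pos[of j] i Suc by simp
  with 1 show ?thesis using Suc by (simp add: T_def algebra_simps)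
qed

lemma T_cone:
  assumes t: "t \<in> mono_cone"
  shows "T t \<in> mono_cone"
  unfolding mono_cone_def
proof (intro CollectI allI impI)
  fix i assume i: "i < N"
  have "0 \<le> (case i of 0 \<Rightarrow> c 0 - a | Suc j \<Rightarrow> c (Suc j) - c j) * t ((N + i) div 2)"
    using c0 c_mono i cone_nonneg[OF t, of "(N + i) div 2"]
    by (intro mult_nonneg_nonneg) (auto split: nat.split intro: less_imp_le)
  then show "0 \<le> inc (T t) i" using inc_T_ge[OF t i] by simp
qed

text \<open>A value of \<open>t\<close> is the sum of the increments up to its index, and
  \<open>(N + i) div 2\<close> is at least the smaller of \<open>Suc i\<close> and
  \<open>N - 1\<close>. Thus a positive increment at \<open>j\<close> spreads to every position from
  \<open>j - 1\<close> on.\<close>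

lemma T_pos:
  assumes t: "t \<in> mono_cone" and i: "i < N" and j: "j < N" "j \<le> Suc i" "0 < inc t j"
  shows "0 < inc (T t) i"
proof -
  have q: "j \<le> (N + i) div 2" "(N + i) div 2 < N" using i j by simp_all
  have "inc t j \<le> t ((N + i) div 2)"
    using coneD[OF t] q by (rule inc_le)
  then have "0 < t ((N + i) div 2)" using j(3) by linarith
  then have "0 < (case i of 0 \<Rightarrow> c 0 - a | Suc j \<Rightarrow> c (Suc j) - c j) * t ((N + i) div 2)"
    using c0 c_mono i by (intro mult_pos_pos) (auto split: nat.split)
  then show ?thesis using inc_T_ge[OF t i] by simp
qed

lemma inc_F: "inc (F t) i = inc t i + inc (T t) i"
proof -
  have "F t = (\<lambda>i. t i + T t i)" by (simp add: F_def fun_eq_iff)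
  then show ?thesis by (simp add: inc_add)
qed

lemma F_cone:
  assumes "t \<in> mono_cone"
  shows "F t \<in> mono_cone"
  using coneD[OF assms] coneD[OF T_cone[OF assms]]
  by (simp add: mono_cone_def inc_F add_nonneg_nonneg)

lemma Fpow_cone: "t \<in> mono_cone \<Longrightarrow> (F ^^ m) t \<in> mono_cone"
  by (induction m) (simp_all add: F_cone)

text \<open>Each application gains one position to the left, so \<open>N\<close> of them reach all
  coordinates.\<close>

lemma Fpow_pos:
  assumes t: "t \<in> mono_cone" and j: "j < N" "0 < inc t j" and i: "i < N" "j \<le> i + Suc m"
  shows "0 < inc ((F ^^ Suc m) t) i"
  using i
proof (induction m arbitrary: i)
  case 0
  then show ?case using T_pos[OF t _ j(1) _ j(2), of i] coneD[OF t, of i] by (simp add: inc_F)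
next
  case (Suc m)
  let ?s = "(F ^^ Suc m) t"
  have s: "?s \<in> mono_cone" using t by (rule Fpow_cone)
  have "0 < inc ?s i + inc (T ?s) i"
  proof (cases "Suc i < N")
    case True
    then have "0 < inc ?s (Suc i)" using Suc.prems by (intro Suc.IH) simp_all
    then have "0 < inc (T ?s) i" using T_pos[OF s _ True] Suc.prems by simp
    then show ?thesis using coneD[OF s Suc.prems(1)] by simp
  next
    \<comment> \<open>The last position has no right neighbour; the identity summand of
      \<open>F\<close> preserves its positivity.\<close>
    case False
    then have "0 < inc ?s i" using Suc.IH[of i] Suc.prems j by simp
    then show ?thesis using coneD[OF T_cone[OF s] Suc.prems(1)] by simp
  qed
  then show ?case by (simp add: inc_F)
qed

lemma FN_pos:
  assumes "t \<in> mono_cone" "j < N" "0 < inc t j" "i < N"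
  shows "0 < inc ((F ^^ N) t) i"
  using Fpow_pos[OF assms, of "N - 1"] assms N by simp

lemma F_linear: "F (\<lambda>i. x i - k * y i) = (\<lambda>i. F x i - k * F y i)"
  by (auto simp: F_def T_def algebra_simps)

lemma Fpow_linear: "(F ^^ m) (\<lambda>i. x i - k * y i) = (\<lambda>i. (F ^^ m) x i - k * (F ^^ m) y i)"
  by (induction m) (simp_all add: F_linear)

lemma F_T: "F (T t) = T (F t)"
  by (auto simp: F_def T_def algebra_simps)

lemma Fpow_T: "(F ^^ m) (T t) = T ((F ^^ m) t)"
  by (induction m) (simp_all add: F_T)

lemma T_cong: "(\<And>j. j < N \<Longrightarrow> x j = y j) \<Longrightarrow> i < N \<Longrightarrow> T x i = T y i"
  by (simp add: T_def)

lemma T_scale: "T (\<lambda>i. k * t i) i = k * T t i"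
  by (simp add: T_def algebra_simps)

lemma T_linear: "T (\<lambda>i. x i - k * y i) i = T x i - k * T y i"
  by (simp add: T_def algebra_simps)

lemma T_last: "T t (N - 1) = - a * t 0 + c (N - 1) * t (N - 1)"
proof -
  have "(N + (N - 1)) div 2 = N - 1" using N by simp
  then show ?thesis by (simp add: T_def)
qed

lemma Fpow_eigen:
  assumes "\<And>i. i < N \<Longrightarrow> T t i = l * t i" "i < N"
  shows "(F ^^ m) t i = (1 + l) ^ m * t i"
  using assms(2)
proof (induction m arbitrary: i)
  case (Suc m)
  have "T ((F ^^ m) t) i = T (\<lambda>i. (1 + l) ^ m * t i) i"
    using Suc by (intro T_cong)
  then have "(F ^^ Suc m) t i = (1 + l) ^ m * t i + (1 + l) ^ m * (l * t i)"
    using Suc.IH[OF Suc.prems] assms(1)[OF Suc.prems] by (simp only: funpow.simps o_apply F_def[of "(F ^^ m) t"] T_scale)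
  then show ?case by (simp add: algebra_simps)
qed simp

text \<open>\<open>F ^^ N\<close> makes all increments positive, yet on an eigenvector it only
  multiplies by \<open>(1 + l) ^ N\<close>. Hence no increment of \<open>t\<close> can vanish, and
  the cone fixes the sign.\<close>

lemma eigen_inc_pos:
  assumes t: "t \<in> mono_cone" "\<And>i. i < N \<Longrightarrow> T t i = l * t i" and j: "j < N" "0 < inc t j"
    and i: "i < N"
  shows "0 < inc t i"
proof -
  have "0 < inc ((F ^^ N) t) i" using FN_pos[OF t(1) j i] .
  also have "inc ((F ^^ N) t) i = inc (\<lambda>i. (1 + l) ^ N * t i) i"
    using Fpow_eigen[OF t(2)] i by (intro inc_cong[of N]) auto
  finally have "inc t i \<noteq> 0" by (auto simp: inc_scale)
  then show ?thesis using coneD[OF t(1) i] by simp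
qed

lemma last_pos_imp_inc_pos:
  assumes "t \<in> mono_cone" "0 < t (N - 1)"
  obtains j where "j < N" "0 < inc t j"
proof -
  have "\<exists>j<N. 0 < inc t j"
  proof (rule ccontr)
    assume "\<not> ?thesis"
    then have "inc t i = 0" if "i < N" for i using coneD[OF assms(1) that] that by force
    from inc_eq_0D[OF this, where i = "N - 1"] show False using assms N by simp
  qed
  then show ?thesis using that by blast
qed

text \<open>\<open>k\<close> is the largest multiple of \<open>t\<close> whose subtraction from
  \<open>s\<close> stays in the cone, so some increment \<open>j\<close> of the difference is zero.
  \<open>T\<close> keeps the difference in the cone, and its increment at \<open>j\<close> equals
  \<open>(m - l) * (k * inc t j)\<close>.\<close>

lemma eigen_compare:
  assumes t: "t \<in> mono_cone" "\<And>i. i < N \<Longrightarrow> T t i = l * t i" "t (N - 1) = 1"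
    and s: "s \<in> mono_cone" "\<And>i. i < N \<Longrightarrow> T s i = m * s i" "s (N - 1) = 1"
  obtains k j where "k > 0" "j < N" "(\<lambda>i. s i - k * t i) \<in> mono_cone" "inc s j = k * inc t j" "l \<le> m"
proof -
  obtain jt where "jt < N" "0 < inc t jt" using last_pos_imp_inc_pos[OF t(1)] t(3) by auto
  moreover obtain js where "js < N" "0 < inc s js" using last_pos_imp_inc_pos[OF s(1)] s(3) by auto
  ultimately have tp: "\<And>i. i < N \<Longrightarrow> 0 < inc t i" and sp: "\<And>i. i < N \<Longrightarrow> 0 < inc s i"
    using eigen_inc_pos[OF t(1,2)] eigen_inc_pos[OF s(1,2)] by blast+
  define k where "k = Min ((\<lambda>i. inc s i / inc t i) ` {..<N})"
  have fin: "finite ((\<lambda>i. inc s i / inc t i) ` {..<N})"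
    "(\<lambda>i. inc s i / inc t i) ` {..<N} \<noteq> {}" using N by auto
  obtain j where j: "j < N" "k = inc s j / inc t j"
    using Min_in[OF fin] unfolding k_def by auto
  have kle: "k \<le> inc s i / inc t i" if "i < N" for i
    unfolding k_def using fin that by (intro Min_le) auto
  have k: "k > 0" using j tp sp by simp
  have y: "(\<lambda>i. s i - k * t i) \<in> mono_cone"
    using kle tp by (auto simp: mono_cone_def inc_linear pos_le_divide_eq)
  have eq: "inc s j = k * inc t j" using j tp[OF j(1)] by simp
  have "0 \<le> inc (T (\<lambda>i. s i - k * t i)) j" using coneD[OF T_cone[OF y] j(1)] .
  also have "\<dots> = inc (\<lambda>i. m * s i - (k * l) * t i) j"
    by (rule inc_cong[OF _ j(1)]) (simp add: T_linear s(2) t(2))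
  also have "\<dots> = (m - l) * (k * inc t j)"
    by (simp add: inc_linear inc_scale eq algebra_simps)
  finally have "0 \<le> (m - l) * (k * inc t j)" .
  moreover have "0 < k * inc t j" using k tp[OF j(1)] by simp
  ultimately have "l \<le> m" by (simp add: zero_le_mult_iff)
  then show ?thesis using that[OF k j(1) y eq] by blast
qed

text \<open>Comparison in both directions makes the eigenvalues equal. Then \<open>s - k t\<close>
  is an eigenvector in the cone with a zero increment, so it vanishes by
  \<open>eigen_inc_pos\<close>, and the normalisation gives \<open>k = 1\<close>.\<close>

lemma eigen_unique:
  assumes t: "t \<in> mono_cone" "\<And>i. i < N \<Longrightarrow> T t i = l * t i" "t (N - 1) = 1"
    and s: "s \<in> mono_cone" "\<And>i. i < N \<Longrightarrow> T s i = m * s i" "s (N - 1) = 1"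
    and i: "i < N"
  shows "s i = t i"
proof -
  obtain k j where k: "k > 0" "j < N" and y: "(\<lambda>i. s i - k * t i) \<in> mono_cone"
    and eq: "inc s j = k * inc t j" and "l \<le> m"
    using eigen_compare[OF t s] .
  have "m \<le> l" using eigen_compare[OF s t] by blast
  then have ml: "m = l" using \<open>l \<le> m\<close> by simp
  have ye: "T (\<lambda>i. s i - k * t i) i = l * (s i - k * t i)" if "i < N" for i
    using s(2) t(2) that ml by (simp add: T_linear algebra_simps)
  have "inc (\<lambda>i. s i - k * t i) i = 0" if "i < N" for i
    using eigen_inc_pos[OF y ye that _ k(2)] coneD[OF y that] eq
    by (fastforce simp: inc_linear)
  from inc_eq_0D[OF this] have z: "s i = k * t i" if "i < N" for i using that by fastforce
  have "k = 1" using z[of "N - 1"] N s(3) t(3) by simp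
  then show ?thesis using z i by simp
qed

text \<open>The eigenvalue is the largest \<open>l\<close> for which some normalised \<open>t\<close> in the cone satisfies
  \<open>T t \<ge> l t\<close> in the mono_cone order: at a maximiser, strict inequality could be improved
  by applying a power of \<open>1 + T\<close>.\<close>

lemma eigen_exists:
  obtains t l where "t \<in> mono_cone" "t (N - 1) = 1" "\<And>i. i < N \<Longrightarrow> T t i = l * t i"
proof -
  define adm where "adm l t \<longleftrightarrow> t \<in> mono_cone \<and> t (N - 1) = 1 \<and> (\<forall>i. 0 \<le> t i \<and> t i \<le> 1) \<and>
    (\<forall>i<N. l * inc t i \<le> inc (T t) i)" for l t
  define A where "A = {l. \<exists>t. adm l t}"
  have adm_normalise: "l \<in> A"
    if t: "t \<in> mono_cone" "0 < t (N - 1)" and le: "\<And>i. i < N \<Longrightarrow> l * inc t i \<le> inc (T t) i" for l t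
  proof -
    \<comment> \<open>The vector is set to 0 beyond \<open>N\<close> so that all its entries lie in
      [0,1]; the compactness argument below runs over every natural index.\<close>
    define s where "s i = (if i < N then (1 / t (N - 1)) * t i else 0)" for i
    have i: "inc s i = (1 / t (N - 1)) * inc t i" if "i < N" for i
      unfolding inc_scale[symmetric] by (rule inc_cong[of N]) (use that in \<open>auto simp: s_def\<close>)
    have iT: "inc (T s) i = (1 / t (N - 1)) * inc (T t) i" if "i < N" for i
    proof -
      have "T s j = 1 / t (N - 1) * T t j" if "j < N" for j
        unfolding T_scale[symmetric] by (rule T_cong) (use that in \<open>auto simp: s_def\<close>)
      then show ?thesis unfolding inc_scale[symmetric] by (rule inc_cong[of N]) (use that in auto)
    qed
    have "t i / t (N - 1) \<le> 1" if "i < N" for i using cone_mono[OF t(1), of i "N - 1"] that t by simp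
    then have "adm l s"
      using t N le cone_nonneg[OF t(1)] coneD[OF t(1)]
      unfolding adm_def mono_cone_def by (auto simp: i iT s_def divide_right_mono)
    then show ?thesis by (auto simp: A_def)
  qed
  have "0 \<in> A"
  proof (rule adm_normalise)
    have "inc (\<lambda>_. 1) i \<ge> 0" for i by (cases i) auto
    then show c: "(\<lambda>_. 1) \<in> mono_cone" by (simp add: mono_cone_def)
    show "0 * inc (\<lambda>_. 1) i \<le> inc (T (\<lambda>_. 1)) i" if "i < N" for i
      using coneD[OF T_cone[OF c] that] by simp
  qed simp
  \<comment> \<open>Summing the increment inequalities yields the inequality of the last
    coordinates, which \<open>T_last\<close> evaluates.\<close>
  have ub: "l \<le> c (N - 1)" if l: "l \<in> A" for l
  proof -
    obtain t where t: "adm l t" using l unfolding A_def by blast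
    have "l * t (N - 1) = (\<Sum>i\<le>N - 1. l * inc t i)"
      by (simp add: sum_inc sum_distrib_left[symmetric])
    also have "\<dots> \<le> (\<Sum>i\<le>N - 1. inc (T t) i)"
      using t N by (intro sum_mono) (auto simp: adm_def)
    also have "\<dots> = - a * t 0 + c (N - 1)" using t unfolding sum_inc T_last by (simp add: adm_def)
    also have "\<dots> \<le> c (N - 1)" using t a by (simp add: adm_def)
    finally show ?thesis using t by (simp add: adm_def)
  qed
  define l where "l = Sup A"
  have bdd: "bdd_above A" by (rule bdd_aboveI) (rule ub)
  have "\<exists>x\<in>A. l - 1 / Suc n < x" for n
    using less_cSup_iff[of A "l - 1 / Suc n"] bdd \<open>0 \<in> A\<close> by (auto simp: l_def)
  then have "\<exists>x t. adm x t \<and> l - 1 / Suc n < x" for n by (auto simp: A_def)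
  then obtain ls ts where ls: "\<And>n. adm (ls n) (ts n)" "\<And>n. l - 1 / Suc n < ls n" by metis
  have lsu: "ls n \<le> l" for n unfolding l_def using bdd ls(1) by (intro cSup_upper) (auto simp: A_def)
  have lsl: "ls \<longlonglongrightarrow> l"
  proof (rule tendsto_sandwich)
    show "\<forall>\<^sub>F n in sequentially. l - 1 / Suc n \<le> ls n"
      by (intro always_eventually allI less_imp_le ls(2))
    show "\<forall>\<^sub>F n in sequentially. ls n \<le> l"
      by (intro always_eventually allI lsu)
    show "(\<lambda>n. l - 1 / Suc n) \<longlonglongrightarrow> l"
      using tendsto_diff[OF tendsto_const[of l] LIMSEQ_inverse_real_of_nat]
      by (simp add: inverse_eq_divide)
  qed (rule tendsto_const)
  have tsn: "norm (ts n i) \<le> 1" for n i using ls(1)[of n] by (simp add: adm_def)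
  obtain r where r: "strict_mono r" "\<And>i. i \<in> UNIV \<Longrightarrow> \<exists>z. (\<lambda>n. ts (r n) i) \<longlonglongrightarrow> z"
    by (rule function_convergent_subsequence[of "UNIV :: nat set" ts 1, OF countableI_type tsn]) blast
  then obtain t where t: "\<And>i. (\<lambda>n. ts (r n) i) \<longlonglongrightarrow> t i" by (metis UNIV_I)
  have lr: "(\<lambda>n. ls (r n)) \<longlonglongrightarrow> l"
    using LIMSEQ_subseq_LIMSEQ[OF lsl r(1)] by (simp add: o_def)
  have tc: "t \<in> mono_cone"
    unfolding mono_cone_def
  proof (intro CollectI allI impI)
    fix i assume "i < N"
    then show "0 \<le> inc t i"
      using ls(1) by (intro tendsto_lowerbound[OF tendsto_inc[OF t]]) (auto simp: adm_def mono_cone_def)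
  qed
  have "(\<lambda>n. ts (r n) (N - 1)) = (\<lambda>_. 1)" using ls(1) by (auto simp: adm_def)
  then have t1: "t (N - 1) = 1" using t[of "N - 1"] by (simp add: LIMSEQ_const_iff)
  have Tlim: "(\<lambda>n. T (ts (r n)) i) \<longlonglongrightarrow> T t i" for i
    unfolding T_def by (intro tendsto_intros t)
  have le: "l * inc t i \<le> inc (T t) i" if "i < N" for i
  proof (rule tendsto_le[OF _ tendsto_inc[OF Tlim] tendsto_mult[OF lr tendsto_inc[OF t]]])
    show "\<forall>\<^sub>F n in sequentially. ls (r n) * inc (ts (r n)) i \<le> inc (T (ts (r n))) i"
      using ls(1) that by (auto simp: adm_def)
  qed simp
  define u where "u i = T t i - l * t i" for i
  have u: "u = (\<lambda>i. T t i - l * t i)" by (simp add: u_def fun_eq_iff)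
  have uc: "u \<in> mono_cone" using le by (simp add: mono_cone_def u inc_linear)
  have "inc u j = 0" if j: "j < N" for j
  proof (rule ccontr)
    assume "inc u j \<noteq> 0"
    then have up: "0 < inc u j" using coneD[OF uc j] by simp
    define s where "s = (F ^^ N) t"
    obtain j' where "j' < N" "0 < inc t j'" using last_pos_imp_inc_pos[OF tc] t1 by auto
    then have sp: "0 < inc s i" if "i < N" for i unfolding s_def using FN_pos[OF tc] that by blast
    have sc: "s \<in> mono_cone" unfolding s_def by (rule Fpow_cone[OF tc])
    \<comment> \<open>\<open>F\<close> is linear and commutes with \<open>T\<close>, so its powers
      carry the defect \<open>u\<close> of \<open>t\<close> to the defect of \<open>s\<close>, whose
      increments are all positive. There is then room for an eigenvalue bound \<open>e\<close> above
      the supremum \<open>l\<close>.\<close>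
    have Fu: "(F ^^ N) u = (\<lambda>i. T s i - l * s i)"
      unfolding s_def Fpow_T[symmetric] Fpow_linear[symmetric] by (simp add: u_def[abs_def])
    have pos: "l * inc s i < inc (T s) i" if "i < N" for i
      using FN_pos[OF uc j up that] unfolding Fu inc_linear by simp
    define e where "e = Min ((\<lambda>i. inc (T s) i / inc s i) ` {..<N})"
    have fin: "finite ((\<lambda>i. inc (T s) i / inc s i) ` {..<N})"
      "(\<lambda>i. inc (T s) i / inc s i) ` {..<N} \<noteq> {}" using N by auto
    have "l < e" unfolding e_def using fin pos sp by (subst Min_gr_iff) (auto simp: pos_less_divide_eq)
    have "e \<in> A"
    proof (rule adm_normalise[OF sc])
      show "0 < s (N - 1)"
        using inc_le[of N s "N - 1" "N - 1"] coneD[OF sc] sp[of "N - 1"] N by simp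
      show "e * inc s i \<le> inc (T s) i" if "i < N" for i
      proof -
        have "e \<le> inc (T s) i / inc s i" unfolding e_def using fin that by (intro Min_le) auto
        then show ?thesis using sp[OF that] by (simp add: pos_le_divide_eq)
      qed
    qed
    then have "e \<le> l" unfolding l_def by (rule cSup_upper[OF _ bdd])
    then show False using \<open>l < e\<close> by simp
  qed
  from inc_eq_0D[OF this] have "T t i = l * t i" if "i < N" for i
    using that by (fastforce simp: u_def)
  then show ?thesis using that tc t1 by blast
qed

end


section \<open>Components of a union of separated intervals\<close>

lemma components_Union_separated_intervals:
  fixes a b :: "nat \<Rightarrow> real"
  assumes le: "\<And>j. j < m \<Longrightarrow> a j \<le> b j"
    and sep: "\<And>j k. j < k \<Longrightarrow> k < m \<Longrightarrow> b j < a k"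
  shows "components (\<Union>j<m. {a j..b j}) = (\<lambda>j. {a j..b j}) ` {..<m}"
proof -
  let ?S = "\<Union>j<m. {a j..b j}"
  have comp: "connected_component_set ?S x = {a j..b j}" if j: "j < m" and x: "x \<in> {a j..b j}" for j x
  proof (rule connected_component_unique[OF x])
    show "{a j..b j} \<subseteq> ?S" using j by blast
    fix C assume C: "x \<in> C" "C \<subseteq> ?S" "connected C"
    show "C \<subseteq> {a j..b j}"
    proof (rule subsetI, rule ccontr)
      fix y assume y: "y \<in> C" "y \<notin> {a j..b j}"
      then obtain k where k: "k < m" "y \<in> {a k..b k}" using C by blast
      have "j \<noteq> k" using k y by auto
      define p q where "p = min j k" and "q = max j k"
      have pq: "p < q" "q < m" using \<open>j \<noteq> k\<close> j k by (auto simp: p_def q_def)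
      \<comment> \<open>A connected set meeting two of the intervals would contain this midpoint of
        the gap just right of interval \<open>p\<close>, but no interval does.\<close>
      define z where "z = (b p + a (Suc p)) / 2"
      have "Suc p < m" using pq by simp
      have bz: "b p < z" "z < a (Suc p)" using sep[of p "Suc p"] \<open>Suc p < m\<close> by (simp_all add: z_def)
      have "a (Suc p) \<le> a q"
        using sep[of "Suc p" q] le[OF \<open>Suc p < m\<close>] pq by (cases "Suc p = q") auto
      then have "min x y \<le> z \<and> z \<le> max x y"
        using x k bz by (cases "j < k") (auto simp: p_def q_def min_def max_def split: if_splits)
      then have "z \<in> C"
        using connectedD_interval[OF C(3) C(1) y(1), of z] connectedD_interval[OF C(3) y(1) C(1), of z]
        by (auto simp: min_def max_def split: if_splits)
      then obtain l where l: "l < m" "z \<in> {a l..b l}" using C by blast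
      show False
      proof (cases "l \<le> p")
        case True
        then have "b l \<le> b p" using sep[of l p] le[of p] pq by (cases "l = p") auto
        then show False using l bz by simp
      next
        case False
        then have "a (Suc p) \<le> a l" using sep[of "Suc p" l] le[OF \<open>Suc p < m\<close>] l
          by (cases "Suc p = l") auto
        then show False using l bz by simp
      qed
    qed
  qed simp
  show ?thesis
  proof
    show "components ?S \<subseteq> (\<lambda>j. {a j..b j}) ` {..<m}"
      by (auto simp: components_def comp)
    show "(\<lambda>j. {a j..b j}) ` {..<m} \<subseteq> components ?S"
    proof (rule image_subsetI)
      fix j assume "j \<in> {..<m}"
      then have j: "j < m" and "a j \<in> {a j..b j}" using le by auto
      then have "{a j..b j} = connected_component_set ?S (a j)" "a j \<in> ?S" using comp by blast+
      then show "{a j..b j} \<in> components ?S" by (auto simp: components_def)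
    qed
  qed
qed

lemma double_eq_or_Suc_iff_div: "k = 2 * i \<or> k = Suc (2 * i) \<longleftrightarrow> k div 2 = (i::nat)"
  by linarith

context concave_feigenbaum
begin

subsection \<open>Inverse branches\<close>

abbreviation sg :: "real \<Rightarrow> real" where "sg \<equiv> feig_sigma g"

abbreviation Lam :: "real set" where "Lam \<equiv> feig_Lambda g"

definition tau0 :: "real \<Rightarrow> real" where "tau0 x = - x / al"

definition tau1 :: "real \<Rightarrow> real" where "tau1 = inv_into (feig_J1 g) sg"

lemma neg_inv_al_eq: "- al * (- 1 / al) = 1" "- al * (1 / al\<^sup>2) = - 1 / al"
  using al_nz by (simp_all add: power2_eq_square)

lemma tau0_al: "tau0 (- al * x) = x" "- al * tau0 x = x"
  using al_nz by (simp_all add: tau0_def)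

lemma tau0_J0_iff: "tau0 x \<in> feig_J0 g \<longleftrightarrow> x \<in> feig_J g"
proof -
  have "x \<in> feig_J g \<longleftrightarrow> - al * (1 / al\<^sup>2) \<le> - al * tau0 x \<and> - al * tau0 x \<le> - al * (- 1 / al)"
    by (simp only: feig_J_eq neg_inv_al_eq tau0_al atLeastAtMost_iff)
  also have "\<dots> \<longleftrightarrow> tau0 x \<in> feig_J0 g"
    using al_pos by (auto simp only: feig_J0_eq atLeastAtMost_iff mult_le_cancel_left neg_less_0_iff_less)
  finally show ?thesis by simp
qed

lemma sigma_tau0: "x \<in> feig_J g \<Longrightarrow> sg (tau0 x) = x"
  using sigma_J0 tau0_J0_iff tau0_al by simp

lemma tau0_sigma: "x \<in> feig_J0 g \<Longrightarrow> tau0 (sg x) = x"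
  using sigma_J0 tau0_al by simp

lemma J1_bounds: "x \<in> feig_J1 g \<Longrightarrow> g (1 / al) \<le> x \<and> x \<le> 1 \<and> 0 < x \<and> x \<in> {-1..1}"
  using J1_pos J1_subset J1_subset_J J_subset by (auto simp: feig_J1_eq)

lemma one_mem: "1 \<in> feig_J g" "1 \<in> feig_J1 g" "g 1 \<in> feig_J g" and g_1_le_1: "g 1 < 1"
proof -
  have "- 1 / al = - (1 / al)" by simp
  then have "- 1 / al < 1" using inv_al_pos by linarith
  then show "1 \<in> feig_J g" "1 \<in> feig_J1 g" "g 1 \<in> feig_J g" "g 1 < 1"
    unfolding feig_J_eq feig_J1_eq g_1 using g_inv_al_bounds
    by (auto simp only: atLeastAtMost_iff)
qed

lemma sigma_less_J1:
  assumes "x \<in> feig_J1 g" "y \<in> feig_J1 g" "x < y"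
  shows "sg x < sg y"
  using g_decreasing[of x y] J1_bounds[OF assms(1)] J1_bounds[OF assms(2)] assms al_pos
  by (simp add: sigma_J1)

lemma sigma_le_J1_iff:
  assumes "x \<in> feig_J1 g" "y \<in> feig_J1 g"
  shows "sg x \<le> sg y \<longleftrightarrow> x \<le> y"
  using sigma_less_J1[OF assms] sigma_less_J1[OF assms(2,1)] by (cases x y rule: linorder_cases) auto

text \<open>On \<open>feig_J1 g\<close> the map is -\<alpha> g, which is convex and so lies above
  its tangents. At the left end of an interval the derivative therefore underestimates the mean
  expansion, which is what \<open>vf_oscillation\<close> uses.\<close>

lemma sigma_slope_J1:
  assumes "x \<in> feig_J1 g" "y \<in> feig_J1 g"
  shows "- al * g' x * (y - x) \<le> sg y - sg x"
proof -
  have "g y \<le> g x + g' x * (y - x)" using g_tangent J1_bounds assms by blast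
  then have "al * g y \<le> al * (g x + g' x * (y - x))" using al_pos by simp
  then show ?thesis using assms by (simp add: sigma_J1 algebra_simps)
qed

lemma sigma_expanding_J1:
  assumes "x \<in> feig_J1 g" "y \<in> feig_J1 g" "x \<le> y"
  shows "al * (y - x) \<le> sg y - sg x"
proof -
  have "al * 1 * (y - x) \<le> al * (- g' x) * (y - x)"
    using g'_J1_less[OF assms(1)] al_pos assms(3) by (intro mult_right_mono mult_left_mono) auto
  then show ?thesis using sigma_slope_J1[OF assms(1,2)] by simp
qed

lemma sigma_1: "sg 1 = 1"
  using sigma_J1[OF one_mem(2)] al_nz by (simp add: g_1)

lemma c3_J1: "g (1 / al) \<in> feig_J1 g"
  using g_inv_al_bounds by (simp add: feig_J1_eq)

lemma sigma_c3: "sg (g (1 / al)) = g 1"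
  unfolding sigma_J1[OF c3_J1] g_g_inv_al neg_inv_al_eq g_1 ..

lemma sigma_J1_mem:
  assumes "x \<in> feig_J1 g"
  shows "sg x \<in> feig_J g"
  using sigma_le_J1_iff[OF c3_J1 assms] sigma_le_J1_iff[OF assms one_mem(2)] J1_bounds[OF assms]
  by (simp add: sigma_1 sigma_c3 feig_J_def)

lemma sigma_J1_surj:
  assumes y: "y \<in> feig_J g"
  shows "y \<in> sg ` feig_J1 g"
proof -
  have c: "continuous_on {g (1 / al)..1} g"
    using g_cont by (rule continuous_on_subset) (use J1_subset_J J_subset feig_J1_eq in blast)
  have 1: "g 1 \<le> - y / al" and 2: "- y / al \<le> g (g (1 / al))"
    unfolding g_g_inv_al g_1 using y tau0_J0_iff[of y]
    by (simp_all add: feig_J0_eq tau0_def)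
  obtain x where x: "g (1 / al) \<le> x" "x \<le> 1" "g x = - y / al"
    using IVT2'[OF 1 2 _ c] g_inv_al_bounds by auto
  then have "x \<in> feig_J1 g" by (simp add: feig_J1_eq)
  moreover from this have "sg x = y" using x(3) al_nz by (simp add: sigma_J1)
  ultimately show ?thesis by blast
qed

lemma tau1_mem: "y \<in> feig_J g \<Longrightarrow> tau1 y \<in> feig_J1 g"
  unfolding tau1_def by (rule inv_into_into[OF sigma_J1_surj])

lemma sigma_tau1: "y \<in> feig_J g \<Longrightarrow> sg (tau1 y) = y"
  unfolding tau1_def by (rule f_inv_into_f[OF sigma_J1_surj])

lemma tau1_eqI: "x \<in> feig_J1 g \<Longrightarrow> tau1 (sg x) = x"
  using sigma_le_J1_iff[OF tau1_mem[OF sigma_J1_mem[of x]], of x]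
    sigma_le_J1_iff[OF _ tau1_mem[OF sigma_J1_mem[of x]], of x] sigma_tau1[OF sigma_J1_mem[of x]]
  by simp

lemma tau1_1: "tau1 1 = 1"
  using tau1_eqI[OF one_mem(2)] by (simp add: sigma_1)

lemma tau1_le_iff:
  assumes "x \<in> feig_J g" "y \<in> feig_J g"
  shows "tau1 x \<le> tau1 y \<longleftrightarrow> x \<le> y"
  using sigma_le_J1_iff[OF tau1_mem[OF assms(1)] tau1_mem[OF assms(2)]] assms
  by (simp add: sigma_tau1)

lemma tau0_le_iff: "tau0 x \<le> tau0 y \<longleftrightarrow> y \<le> x"
  using al_pos by (simp add: tau0_def divide_le_cancel)

lemma tau0_mem: "x \<in> feig_J g \<Longrightarrow> tau0 x \<in> feig_J0 g"
  by (simp add: tau0_J0_iff)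

lemma preimages_eq:
  assumes "x \<in> feig_J g"
  shows "{y \<in> feig_dom g. sg y = x} = {tau0 x, tau1 x}"
  using assms tau0_mem tau1_mem sigma_tau0 sigma_tau1 tau0_sigma tau1_eqI
  by (auto simp: feig_dom_def)

lemma transfer_op_eq:
  assumes "x \<in> feig_J g"
  shows "transfer_op g w v x = w (tau0 x) * v (tau0 x) + w (tau1 x) * v (tau1 x)"
proof -
  have "tau0 x \<noteq> tau1 x" using J0_less_J1[OF tau0_mem tau1_mem] assms by force
  then show ?thesis unfolding transfer_op_def preimages_eq[OF assms] by simp
qed

lemma Lam_iff: "x \<in> Lam \<longleftrightarrow> x \<in> feig_dom g \<and> sg x \<in> Lam"
proof -
  have "(\<forall>n. (sg ^^ n) x \<in> feig_dom g) \<longleftrightarrow>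
    (sg ^^ 0) x \<in> feig_dom g \<and> (\<forall>n. (sg ^^ Suc n) x \<in> feig_dom g)"
    by (metis not0_implies_Suc)
  then show ?thesis by (simp add: feig_Lambda_def funpow_swap1)
qed

lemma Lam_J: "x \<in> Lam \<Longrightarrow> x \<in> feig_J g"
  using Lam_iff dom_subset_J by blast

lemma tau0_Lam: "x \<in> Lam \<Longrightarrow> tau0 x \<in> Lam"
  using Lam_iff[of "tau0 x"] tau0_mem sigma_tau0 Lam_J by (simp add: feig_dom_def)

lemma tau1_Lam: "x \<in> Lam \<Longrightarrow> tau1 x \<in> Lam"
  using Lam_iff[of "tau1 x"] tau1_mem sigma_tau1 Lam_J by (simp add: feig_dom_def)

lemma one_Lam: "1 \<in> Lam"
proof -
  have "(sg ^^ n) 1 = 1" for n by (induction n) (simp_all add: sigma_1)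
  then show ?thesis using one_mem by (simp add: feig_Lambda_def feig_dom_def)
qed


subsection \<open>The pieces of the preimages of the interval\<close>

text \<open>Pieces are numbered from left to right starting with \<open>0\<close>; \<open>tau0\<close> reverses the order.\<close>

primrec ends :: "nat \<Rightarrow> nat \<Rightarrow> real \<times> real" where
  "ends 0 j = (g 1, 1)"
| "ends (Suc n) j =
     (if j < 2 ^ n then (tau0 (snd (ends n (2 ^ n - 1 - j))), tau0 (fst (ends n (2 ^ n - 1 - j))))
      else (tau1 (fst (ends n (j - 2 ^ n))), tau1 (snd (ends n (j - 2 ^ n)))))"

abbreviation lo :: "nat \<Rightarrow> nat \<Rightarrow> real" where "lo n j \<equiv> fst (ends n j)"
abbreviation hi :: "nat \<Rightarrow> nat \<Rightarrow> real" where "hi n j \<equiv> snd (ends n j)"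

definition piece :: "nat \<Rightarrow> nat \<Rightarrow> real set" where "piece n j = {lo n j..hi n j}"

lemma ends_J:
  assumes "j < 2 ^ n"
  shows "lo n j \<in> feig_J g \<and> hi n j \<in> feig_J g \<and> lo n j < hi n j"
  using assms
proof (induction n arbitrary: j)
  case 0
  then show ?case using one_mem g_1_le_1 by simp
next
  case (Suc n)
  show ?case
  proof (cases "j < 2 ^ n")
    case True
    have "2 ^ n - 1 - j < 2 ^ n" using True by simp
    from Suc.IH[OF this] show ?thesis
      using True tau0_mem J0_subset_J tau0_le_iff by (simp add: not_le[symmetric]) blast
  next
    case False
    have "j - 2 ^ n < 2 ^ n" using False Suc.prems by simp
    from Suc.IH[OF this] show ?thesis
      using False tau1_mem J1_subset_J tau1_le_iff by (simp add: not_le[symmetric]) blast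
  qed
qed

lemma ends_J0: "j < 2 ^ n \<Longrightarrow> lo (Suc n) j \<in> feig_J0 g \<and> hi (Suc n) j \<in> feig_J0 g"
  using ends_J[of "2 ^ n - 1 - j" n] tau0_mem by simp

lemma ends_J1: "\<not> j < 2 ^ n \<Longrightarrow> j < 2 ^ Suc n \<Longrightarrow> lo (Suc n) j \<in> feig_J1 g \<and> hi (Suc n) j \<in> feig_J1 g"
  using ends_J[of "j - 2 ^ n" n] tau1_mem by simp

lemma ends_separated:
  assumes "j < k" "k < 2 ^ n"
  shows "hi n j < lo n k"
  using assms
proof (induction n arbitrary: j k)
  case (Suc n)
  consider "k < 2 ^ n" | "j < 2 ^ n" "\<not> k < 2 ^ n" | "\<not> j < 2 ^ n" using Suc.prems by linarith
  then show ?case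
  proof cases
    case 1
    have "hi n (2 ^ n - 1 - k) < lo n (2 ^ n - 1 - j)" using 1 Suc.prems by (intro Suc.IH) auto
    then show ?thesis using 1 Suc.prems tau0_le_iff by (simp add: not_le[symmetric])
  next
    case 2
    then show ?thesis using ends_J0 ends_J1 J0_less_J1 Suc.prems by blast
  next
    case 3
    have l: "hi n (j - 2 ^ n) < lo n (k - 2 ^ n)" using 3 Suc.prems by (intro Suc.IH) auto
    have "hi n (j - 2 ^ n) \<in> feig_J g" "lo n (k - 2 ^ n) \<in> feig_J g"
      using ends_J[of "j - 2 ^ n" n] ends_J[of "k - 2 ^ n" n] 3 Suc.prems by auto
    then show ?thesis using 3 Suc.prems l tau1_le_iff by (simp add: not_le[symmetric])
  qed
qed simp

lemma hi_last: "hi n (2 ^ n - 1) = 1"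
proof (induction n)
  case (Suc n)
  have "\<not> 2 ^ Suc n - 1 < (2::nat) ^ n" "2 ^ Suc n - 1 - 2 ^ n = (2::nat) ^ n - 1" by auto
  then show ?case using Suc by (simp add: tau1_1)
qed simp

lemma piece_subset_J: "j < 2 ^ n \<Longrightarrow> piece n j \<subseteq> feig_J g"
  using ends_J[of j n] by (auto simp: piece_def feig_J_eq)

lemma piece_Suc_J0_iff:
  assumes "j < 2 ^ n"
  shows "x \<in> piece (Suc n) j \<longleftrightarrow> x \<in> feig_J0 g \<and> sg x \<in> piece n (2 ^ n - 1 - j)"
proof
  assume x: "x \<in> piece (Suc n) j"
  then have J0: "x \<in> feig_J0 g" using ends_J0[OF assms] by (auto simp: piece_def feig_J0_eq)
  have "sg x \<in> piece n (2 ^ n - 1 - j)"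
    using x assms tau0_le_iff[of _ "sg x"] tau0_le_iff[of "sg x"] tau0_sigma[OF J0]
    by (simp add: piece_def)
  then show "x \<in> feig_J0 g \<and> sg x \<in> piece n (2 ^ n - 1 - j)" using J0 by blast
next
  assume x: "x \<in> feig_J0 g \<and> sg x \<in> piece n (2 ^ n - 1 - j)"
  then show "x \<in> piece (Suc n) j"
    using assms tau0_le_iff[of _ "sg x"] tau0_le_iff[of "sg x"] tau0_sigma[of x]
    by (simp add: piece_def)
qed

lemma piece_Suc_J1_iff:
  assumes "\<not> j < 2 ^ n" "j < 2 ^ Suc n"
  shows "x \<in> piece (Suc n) j \<longleftrightarrow> x \<in> feig_J1 g \<and> sg x \<in> piece n (j - 2 ^ n)"
proof -
  have e: "lo n (j - 2 ^ n) \<in> feig_J g" "hi n (j - 2 ^ n) \<in> feig_J g"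
    using ends_J[of "j - 2 ^ n" n] assms by auto
  have "x \<in> feig_J1 g" if "x \<in> piece (Suc n) j"
    using that ends_J1[OF assms] by (auto simp: piece_def feig_J1_eq)
  moreover have "x \<in> piece (Suc n) j \<longleftrightarrow> sg x \<in> piece n (j - 2 ^ n)" if x: "x \<in> feig_J1 g"
    using tau1_le_iff[OF e(1) sigma_J1_mem[OF x]] tau1_le_iff[OF sigma_J1_mem[OF x] e(2)]
      tau1_eqI[OF x] assms by (simp add: piece_def)
  ultimately show ?thesis by blast
qed

lemma piece_disjoint:
  assumes "j < 2 ^ n" "k < 2 ^ n" "x \<in> piece n j" "x \<in> piece n k"
  shows "j = k"
  using ends_separated[of j k n] ends_separated[of k j n] assms
  by (cases j k rule: linorder_cases) (auto simp: piece_def)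

lemma sigma_preimage_Suc: "sigma_preimage g (Suc n) = {x \<in> feig_dom g. sg x \<in> sigma_preimage g n}"
  unfolding sigma_preimage_def by (auto simp: All_less_Suc2 funpow_swap1)

lemma sigma_preimage_eq: "sigma_preimage g n = (\<Union>j<2 ^ n. piece n j)"
proof (induction n)
  case 0
  show ?case by (auto simp: sigma_preimage_def piece_def feig_J_def lessThan_Suc)
next
  case (Suc n)
  have "x \<in> feig_dom g \<and> (\<exists>i<2 ^ n. sg x \<in> piece n i) \<longleftrightarrow> (\<exists>j<2 ^ Suc n. x \<in> piece (Suc n) j)" for x
  proof
    assume "x \<in> feig_dom g \<and> (\<exists>i<2 ^ n. sg x \<in> piece n i)"
    then obtain i where x: "x \<in> feig_dom g" and i: "i < 2 ^ n" "sg x \<in> piece n i" by blast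
    show "\<exists>j<2 ^ Suc n. x \<in> piece (Suc n) j"
    proof (cases "x \<in> feig_J0 g")
      case True
      have "2 ^ n - 1 - (2 ^ n - 1 - i) = i" "2 ^ n - 1 - i < (2::nat) ^ n" using i by auto
      then show ?thesis using piece_Suc_J0_iff[of "2 ^ n - 1 - i" n x] True i
        by (intro exI[of _ "2 ^ n - 1 - i"]) auto
    next
      case False
      then have "x \<in> feig_J1 g" using x by (simp add: feig_dom_def)
      then show ?thesis using piece_Suc_J1_iff[of "2 ^ n + i" n x] i
        by (intro exI[of _ "2 ^ n + i"]) auto
    qed
  next
    assume "\<exists>j<2 ^ Suc n. x \<in> piece (Suc n) j"
    then obtain j where j: "j < 2 ^ Suc n" "x \<in> piece (Suc n) j" by blast
    show "x \<in> feig_dom g \<and> (\<exists>i<2 ^ n. sg x \<in> piece n i)"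
    proof (cases "j < 2 ^ n")
      case True
      then show ?thesis using piece_Suc_J0_iff[OF True] j
        by (auto simp: feig_dom_def intro!: exI[of _ "2 ^ n - 1 - j"])
    next
      case False
      then show ?thesis using piece_Suc_J1_iff[OF False j(1)] j
        by (auto simp: feig_dom_def intro!: exI[of _ "j - 2 ^ n"])
    qed
  qed
  then show ?case unfolding sigma_preimage_Suc Suc.IH by auto
qed

lemma components_sigma_preimage:
  "components (sigma_preimage g n) = piece n ` {..<2 ^ n}"
  unfolding sigma_preimage_eq piece_def[abs_def]
  by (rule components_Union_separated_intervals)
    (use ends_J ends_separated in \<open>auto intro: less_imp_le\<close>)

lemma piece_Inf_Sup: "j < 2 ^ n \<Longrightarrow> Inf (piece n j) = lo n j" "j < 2 ^ n \<Longrightarrow> Sup (piece n j) = hi n j"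
  using ends_J[of j n] by (simp_all add: piece_def)

text \<open>Exactly \<open>k\<close> components lie to the left of \<open>piece n k\<close>, so the
  count determines the piece. \<open>Suc\<close> translates to the numbering of
  \<open>J_piece\<close>, which starts at 1.\<close>

lemma J_piece_eq:
  assumes j: "j < 2 ^ n"
  shows "J_piece g n (Suc j) = piece n j"
proof -
  have inj: "inj_on (piece n) {..<2 ^ n}"
  proof (rule inj_onI)
    fix i k assume ik: "i \<in> {..<2 ^ n}" "k \<in> {..<2 ^ n}" "piece n i = piece n k"
    have "lo n i \<in> piece n i" using ends_J[of i n] ik by (auto simp: piece_def)
    then show "i = k" using piece_disjoint[of i n k "lo n i"] ik by auto
  qed
  have card: "card {D \<in> components (sigma_preimage g n). Sup D < Inf (piece n k)} = k"
    if k: "k < 2 ^ n" for k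
  proof -
    have "{D \<in> components (sigma_preimage g n). Sup D < Inf (piece n k)} = piece n ` {..<k}"
    proof (intro equalityI subsetI)
      fix D assume "D \<in> {D \<in> components (sigma_preimage g n). Sup D < Inf (piece n k)}"
      then obtain i where i: "i < 2 ^ n" "D = piece n i" "hi n i < lo n k"
        using k by (auto simp: components_sigma_preimage piece_Inf_Sup)
      then have "i < k"
        using ends_separated[of k i n] ends_J[of i n] ends_J[of k n] k
        by (cases i k rule: linorder_cases) auto
      then show "D \<in> piece n ` {..<k}" using i by blast
    next
      fix D assume "D \<in> piece n ` {..<k}"
      then show "D \<in> {D \<in> components (sigma_preimage g n). Sup D < Inf (piece n k)}"
        using k ends_separated[of _ k n] by (auto simp: components_sigma_preimage piece_Inf_Sup)
    qed
    moreover have "inj_on (piece n) {..<k}" using inj by (rule inj_on_subset) (use k in auto)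
    ultimately show ?thesis by (simp add: card_image)
  qed
  show ?thesis
    unfolding J_piece_def
  proof (rule the_equality)
    show "piece n j \<in> components (sigma_preimage g n) \<and>
      card {D \<in> components (sigma_preimage g n). Sup D < Inf (piece n j)} = Suc j - 1"
      using j card[OF j] by (simp add: components_sigma_preimage)
    fix C assume C: "C \<in> components (sigma_preimage g n) \<and>
      card {D \<in> components (sigma_preimage g n). Sup D < Inf C} = Suc j - 1"
    then obtain k where k: "k < 2 ^ n" "C = piece n k" by (auto simp: components_sigma_preimage)
    then show "C = piece n j" using C card[OF k(1)] by simp
  qed
qed

text \<open>Halving commutes with the index maps of both branches: with the reflection in the left
  half and with the shift in the right half.\<close>

lemma piece_parent:
  assumes "j < 2 ^ Suc n"
  shows "piece (Suc n) j \<subseteq> piece n (j div 2)"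
  using assms
proof (induction n arbitrary: j)
  case 0
  then have "j div 2 = 0" by simp
  then show ?case using piece_subset_J[OF 0] by (simp add: piece_def feig_J_def)
next
  case (Suc n)
  show ?case
  proof (cases "j < 2 ^ Suc n")
    case True
    have i: "2 ^ Suc n - 1 - j < 2 ^ Suc n" "j div 2 < 2 ^ n" using True by auto
    have "(2 ^ Suc n - 1 - j) div 2 = 2 ^ n - 1 - j div 2" using True by simp
    then show ?thesis
      using Suc.IH[OF i(1)] piece_Suc_J0_iff[OF True] piece_Suc_J0_iff[OF i(2)] by auto
  next
    case False
    have i: "j - 2 ^ Suc n < 2 ^ Suc n" "\<not> j div 2 < 2 ^ n" "j div 2 < 2 ^ Suc n"
      using False Suc.prems by auto
    have "(j - 2 ^ Suc n) div 2 = j div 2 - 2 ^ n" using False by simp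
    then show ?thesis
      using Suc.IH[OF i(1)] piece_Suc_J1_iff[OF False Suc.prems] piece_Suc_J1_iff[OF i(2,3)] by auto
  qed
qed

lemma length_tau0: "tau0 x - tau0 y = (y - x) / al"
  by (simp add: tau0_def diff_divide_distrib)

lemma length_tau1:
  assumes "x \<in> feig_J g" "y \<in> feig_J g" "x \<le> y"
  shows "tau1 y - tau1 x \<le> (y - x) / al"
  using sigma_expanding_J1[of "tau1 x" "tau1 y"] assms al_pos
  by (simp add: tau1_mem sigma_tau1 tau1_le_iff pos_le_divide_eq mult.commute)

lemma piece_length:
  assumes "j < 2 ^ n"
  shows "hi n j - lo n j \<le> 2 / al ^ n"
  using assms
proof (induction n arbitrary: j)
  case 0
  then show ?case using g_maps[of 1] by simp
next
  case (Suc n)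
  show ?case
  proof (cases "j < 2 ^ n")
    case True
    have i: "2 ^ n - 1 - j < 2 ^ n" using True by simp
    have "hi (Suc n) j - lo (Suc n) j = (hi n (2 ^ n - 1 - j) - lo n (2 ^ n - 1 - j)) / al"
      using True by (simp add: length_tau0)
    also have "\<dots> \<le> (2 / al ^ n) / al" using Suc.IH[OF i] al_pos by (intro divide_right_mono) auto
    finally show ?thesis by (simp add: mult.commute)
  next
    case False
    have i: "j - 2 ^ n < 2 ^ n" using False Suc.prems by simp
    have "hi (Suc n) j - lo (Suc n) j \<le> (hi n (j - 2 ^ n) - lo n (j - 2 ^ n)) / al"
      using False length_tau1 ends_J[OF i] by (simp add: less_imp_le)
    also have "\<dots> \<le> (2 / al ^ n) / al" using Suc.IH[OF i] al_pos by (intro divide_right_mono) auto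
    finally show ?thesis by (simp add: mult.commute)
  qed
qed

end


context concave_feigenbaum
begin

subsection \<open>The approximating operators\<close>

definition idx :: "nat \<Rightarrow> real \<Rightarrow> nat" where
  "idx n x = (THE j. j < 2 ^ n \<and> x \<in> piece n j)"

lemma idx_eqI: "j < 2 ^ n \<Longrightarrow> x \<in> piece n j \<Longrightarrow> idx n x = j"
  unfolding idx_def by (rule the_equality) (auto dest: piece_disjoint)

lemma Lam_subset_preimage: "x \<in> Lam \<Longrightarrow> x \<in> sigma_preimage g n"
proof -
  assume "x \<in> Lam"
  then have "(sg ^^ k) x \<in> feig_dom g" for k by (simp add: feig_Lambda_def)
  then show ?thesis using dom_subset_J by (auto simp: sigma_preimage_def)
qed

lemma idx_Lam:
  assumes "x \<in> Lam"
  shows "idx n x < 2 ^ n" "x \<in> piece n (idx n x)"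
proof -
  obtain j where j: "j < 2 ^ n" "x \<in> piece n j"
    using Lam_subset_preimage[OF assms, of n] by (auto simp: sigma_preimage_eq)
  then show "idx n x < 2 ^ n" "x \<in> piece n (idx n x)" using idx_eqI[OF j] by simp_all
qed

lemma idx_Suc_div_2: "x \<in> Lam \<Longrightarrow> idx (Suc n) x div 2 = idx n x"
  using idx_Lam[of x "Suc n"] piece_parent[of "idx (Suc n) x" n]
  by (intro idx_eqI[symmetric]) auto

lemma tau0_piece: "x \<in> feig_J g \<Longrightarrow> j < 2 ^ n \<Longrightarrow> x \<in> piece n j \<Longrightarrow> tau0 x \<in> piece (Suc n) (2 ^ n - 1 - j)"
  using piece_Suc_J0_iff[of "2 ^ n - 1 - j" n "tau0 x"] tau0_mem[of x] sigma_tau0[of x] by simp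

lemma tau1_piece: "x \<in> feig_J g \<Longrightarrow> j < 2 ^ n \<Longrightarrow> x \<in> piece n j \<Longrightarrow> tau1 x \<in> piece (Suc n) (2 ^ n + j)"
  using piece_Suc_J1_iff[of "2 ^ n + j" n "tau1 x"] tau1_mem[of x] sigma_tau1[of x] by simp

lemma idx_tau0: "x \<in> Lam \<Longrightarrow> idx (Suc n) (tau0 x) = 2 ^ n - 1 - idx n x"
  using tau0_piece[OF Lam_J idx_Lam, of x n] by (intro idx_eqI) (auto simp: less_imp_diff_less)

lemma idx_tau1: "x \<in> Lam \<Longrightarrow> idx (Suc n) (tau1 x) = 2 ^ n + idx n x"
  using tau1_piece[OF Lam_J idx_Lam, of x n] idx_Lam(1)[of x n] by (intro idx_eqI) auto

text \<open>Every piece of level n+1 is the image of a piece of level n under one of the inverse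
  branches. This serves both for \<open>feig_Lambda g\<close> and for the critical orbit.\<close>

lemma piece_meets_backward_invariant:
  assumes "1 \<in> S" and "\<And>x. x \<in> S \<Longrightarrow> x \<in> feig_J g \<and> tau0 x \<in> S \<and> tau1 x \<in> S"
    and "j < 2 ^ n"
  shows "\<exists>x\<in>S. x \<in> piece n j"
  using assms(3)
proof (induction n arbitrary: j)
  case 0
  then show ?case using assms(1) g_1_le_1 by (intro bexI[of _ 1]) (simp_all add: piece_def)
next
  case (Suc n)
  show ?case
  proof (cases "j < 2 ^ n")
    case True
    have "2 ^ n - 1 - j < 2 ^ n" and e: "2 ^ n - 1 - (2 ^ n - 1 - j) = j" using True by auto
    with Suc.IH obtain x where "x \<in> S" "x \<in> piece n (2 ^ n - 1 - j)" by blast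
    then show ?thesis using tau0_piece[of x "2 ^ n - 1 - j" n] assms(2)[of x] True e by auto
  next
    case False
    have "j - 2 ^ n < 2 ^ n" and e: "2 ^ n + (j - 2 ^ n) = j" using False Suc.prems by auto
    with Suc.IH obtain x where "x \<in> S" "x \<in> piece n (j - 2 ^ n)" by blast
    then show ?thesis using tau1_piece[of x "j - 2 ^ n" n] assms(2)[of x] \<open>j - 2 ^ n < 2 ^ n\<close> e by auto
  qed
qed

lemma idx_surj:
  assumes "j < 2 ^ n"
  obtains x where "x \<in> Lam" "idx n x = j"
  using piece_meets_backward_invariant[OF one_Lam _ assms] Lam_J tau0_Lam tau1_Lam idx_eqI[OF assms]
  by blast

text \<open>The value of \<open>phi_approx\<close> on the right branch, with |g'| written as -g'
  because g' is negative on \<open>feig_J1 g\<close>. From here on n is written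
  \<open>Suc m\<close>: \<open>i\<close> numbers a piece of level \<open>m\<close>, and
  \<open>2 ^ m + i\<close> its right preimage at level \<open>Suc m\<close>.\<close>

definition wt :: "nat \<Rightarrow> nat \<Rightarrow> real" where
  "wt m i = - al * g' (hi (Suc m) (2 ^ m + i))"

lemma hi_Suc_J1: "i < 2 ^ m \<Longrightarrow> hi (Suc m) (2 ^ m + i) \<in> feig_J1 g"
  using ends_J1[of "2 ^ m + i" m] by simp

lemma beta_eq:
  assumes "i < 2 ^ m"
  shows "al * beta g (Suc m) (Suc i) = wt m i"
proof -
  have "J_piece g (Suc m) (2 ^ (Suc m - 1) + Suc i) = piece (Suc m) (2 ^ m + i)"
    using J_piece_eq[of "2 ^ m + i" "Suc m"] assms by simp
  then show ?thesis
    using g'_J1_less[OF hi_Suc_J1[OF assms]] piece_Inf_Sup(2)[of "2 ^ m + i" "Suc m"] assms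
    by (simp add: beta_def wt_def)
qed

lemma phi_approx_eq:
  "phi_approx g (Suc m) x = - al * indicator (feig_J0 g) x
     + (\<Sum>i<2 ^ m. wt m i * indicator (piece (Suc m) (2 ^ m + i)) x)"
proof -
  have "(\<Sum>i = 1..2 ^ m. al * beta g (Suc m) i * indicator (J_piece g (Suc m) (2 ^ m + i)) x)
    = (\<Sum>i<2 ^ m. al * beta g (Suc m) (Suc i) * indicator (J_piece g (Suc m) (2 ^ m + Suc i)) x)"
    unfolding One_nat_def sum.atLeast1_atMost_eq ..
  also have "\<dots> = (\<Sum>i<2 ^ m. wt m i * indicator (piece (Suc m) (2 ^ m + i)) x)"
    using J_piece_eq[of "2 ^ m + _" "Suc m"] by (intro sum.cong) (simp_all add: beta_eq)
  finally show ?thesis by (simp add: phi_approx_def)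
qed

lemma phi_approx_tau0:
  assumes "x \<in> feig_J g"
  shows "phi_approx g (Suc m) (tau0 x) = - al"
proof -
  have "tau0 x \<notin> piece (Suc m) (2 ^ m + i)" if "i < 2 ^ m" for i
    using piece_Suc_J1_iff[of "2 ^ m + i" m "tau0 x"] J0_less_J1[OF tau0_mem[OF assms], of "tau0 x"] that
    by auto
  then show ?thesis using tau0_mem[OF assms] by (simp add: phi_approx_eq)
qed

lemma phi_approx_tau1:
  assumes "x \<in> Lam"
  shows "phi_approx g (Suc m) (tau1 x) = wt m (idx m x)"
proof -
  have J1: "tau1 x \<notin> feig_J0 g"
    using J0_less_J1[OF _ tau1_mem[OF Lam_J[OF assms]], of "tau1 x"] by auto
  have "tau1 x \<in> piece (Suc m) (2 ^ m + i) \<longleftrightarrow> i = idx m x" if i: "i < 2 ^ m" for i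
  proof
    assume "tau1 x \<in> piece (Suc m) (2 ^ m + i)"
    then have "idx (Suc m) (tau1 x) = 2 ^ m + i" using i by (intro idx_eqI) simp_all
    then show "i = idx m x" using idx_tau1[OF assms, of m] by simp
  qed (use tau1_piece[OF Lam_J[OF assms] idx_Lam[OF assms], of m] in simp)
  then have "indicator (piece (Suc m) (2 ^ m + i)) (tau1 x) = (if i = idx m x then 1 else 0 :: real)"
    if "i < 2 ^ m" for i
    using that by (simp add: indicator_def)
  then have "(\<Sum>i<2 ^ m. wt m i * indicator (piece (Suc m) (2 ^ m + i)) (tau1 x))
    = (\<Sum>i<2 ^ m. if i = idx m x then wt m i else 0)"
    by (intro sum.cong) auto
  then show ?thesis using J1 idx_Lam(1)[OF assms, of m] by (simp add: phi_approx_eq)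
qed

lemma L_approx_eq:
  assumes "x \<in> Lam"
  shows "L_approx g (Suc m) v x = - al * v (tau0 x) + wt m (idx m x) * v (tau1 x)"
  unfolding L_approx_def transfer_op_eq[OF Lam_J[OF assms]]
    phi_approx_tau0[OF Lam_J[OF assms]] phi_approx_tau1[OF assms] ..

text \<open>The two pieces in \<open>k_fun\<close> are the children of piece \<open>i\<close> of
  level \<open>m\<close>, so on \<open>feig_Lambda g\<close> their union is that parent
  piece.\<close>

lemma k_fun_eq:
  assumes x: "x \<in> Lam" and i: "i < 2 ^ m"
  shows "k_fun g (Suc m) (Suc i) x = (if idx m x = i then 1 else 0)"
proof -
  have "J_piece g (Suc m) (2 * Suc i - 1) = piece (Suc m) (2 * i)"
    "J_piece g (Suc m) (2 * Suc i) = piece (Suc m) (Suc (2 * i))"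
    using J_piece_eq[of "2 * i" "Suc m"] J_piece_eq[of "Suc (2 * i)" "Suc m"] i by simp_all
  moreover have "x \<in> piece (Suc m) (2 * i) \<union> piece (Suc m) (Suc (2 * i)) \<longleftrightarrow> idx m x = i"
  proof -
    have "x \<in> piece (Suc m) j \<longleftrightarrow> idx (Suc m) x = j" if "j < 2 ^ Suc m" for j
      using idx_eqI[OF that] idx_Lam[OF x, of "Suc m"] by auto
    then have "x \<in> piece (Suc m) (2 * i) \<union> piece (Suc m) (Suc (2 * i)) \<longleftrightarrow>
        idx (Suc m) x = 2 * i \<or> idx (Suc m) x = Suc (2 * i)"
      using i by simp
    then show ?thesis by (simp add: double_eq_or_Suc_iff_div idx_Suc_div_2[OF x])
  qed
  ultimately show ?thesis using x by (simp add: k_fun_def indicator_def)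
qed

lemma sum_k_fun:
  assumes "x \<in> Lam"
  shows "(\<Sum>i<2 ^ m. f i * k_fun g (Suc m) (Suc i) x) = f (idx m x)"
proof -
  have "(\<Sum>i<2 ^ m. f i * k_fun g (Suc m) (Suc i) x) = (\<Sum>i<2 ^ m. if i = idx m x then f i else 0)"
  proof (rule sum.cong[OF refl])
    fix i :: nat assume "i \<in> {..<2 ^ m}"
    then show "f i * k_fun g (Suc m) (Suc i) x = (if i = idx m x then f i else 0)"
      using k_fun_eq[OF assms, of i m] by auto
  qed
  also have "\<dots> = f (idx m x)" using idx_Lam(1)[OF assms, of m] by (simp only: sum.delta finite_lessThan lessThan_iff if_True)
  finally show ?thesis .
qed

text \<open>The first weight exceeds \<alpha> because g' < -1 on \<open>feig_J1 g\<close>.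
  Consecutive weights increase strictly because the right ends move to the right and g' is strictly
  decreasing.\<close>

sublocale op: cone_operator "2 ^ m" al "wt m" for m
proof
  show "al < wt m 0"
    using mult_strict_left_mono[of 1 "- g' (hi (Suc m) (2 ^ m + 0))" al]
      g'_J1_less[OF hi_Suc_J1[of 0 m]] al_pos unfolding wt_def by simp
  show "wt m i < wt m (Suc i)" if i: "Suc i < 2 ^ m" for i
  proof -
    have "hi (Suc m) (2 ^ m + i) < hi (Suc m) (2 ^ m + Suc i)"
      using ends_separated[of "2 ^ m + i" "2 ^ m + Suc i" "Suc m"] ends_J[of "2 ^ m + Suc i" "Suc m"] i
      by simp
    then have "g' (hi (Suc m) (2 ^ m + Suc i)) < g' (hi (Suc m) (2 ^ m + i))"
      using J1_bounds[OF hi_Suc_J1[of i m]] J1_bounds[OF hi_Suc_J1[OF i]] i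
      by (intro g'_strict_antimono) auto
    then show ?thesis using al_pos by (simp add: wt_def)
  qed
qed (use al_pos in auto)

lemma T_idx:
  assumes "x \<in> Lam"
  shows "op.T m t (idx m x) = - al * t (idx m (tau0 x)) + wt m (idx m x) * t (idx m (tau1 x))"
  using idx_Suc_div_2[OF tau0_Lam[OF assms], of m] idx_Suc_div_2[OF tau1_Lam[OF assms], of m]
    idx_tau0[OF assms, of m] idx_tau1[OF assms, of m]
  by (simp add: op.T_def)

text \<open>The last piece ends at the fixed point 1 of \<sigma>, where g' = -\<alpha>.\<close>

lemma wt_last: "wt m (2 ^ m - 1) = al\<^sup>2"
proof -
  have "2 ^ m + (2 ^ m - 1) = (2::nat) ^ Suc m - 1" by simp
  then show ?thesis unfolding wt_def by (simp only: hi_last g'_1) (simp add: power2_eq_square)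
qed

definition Amat :: "nat \<Rightarrow> real mat" where
  "Amat m = mat (2 ^ m) (2 ^ m) (\<lambda>(i, j). op.T m (\<lambda>k. if k = j then 1 else 0) i)"

text \<open>Uniqueness of the matrix rests on \<open>idx_surj\<close>: every piece contains a point
  of \<open>feig_Lambda g\<close>, and evaluating there isolates a single entry.\<close>

lemma A_mat_eq: "A_mat g (Suc m) = Amat m"
proof -
  let ?e = "\<lambda>j k. if k = j then 1 else 0 :: real"
  have L: "L_approx g (Suc m) (k_fun g (Suc m) (Suc j)) x = op.T m (?e j) (idx m x)"
    if "j < 2 ^ m" "x \<in> Lam" for j x
    using that by (simp add: L_approx_eq T_idx k_fun_eq tau0_Lam tau1_Lam)
  show ?thesis
    unfolding A_mat_def diff_Suc_1
  proof (rule the_equality, intro conjI allI impI ballI)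
    show "Amat m \<in> carrier_mat (2 ^ m) (2 ^ m)" by (simp add: Amat_def)
    show "L_approx g (Suc m) (k_fun g (Suc m) (Suc j)) x =
        (\<Sum>i<2 ^ m. Amat m $$ (i, j) * k_fun g (Suc m) (Suc i) x)"
      if "j < 2 ^ m" "x \<in> Lam" for j x
      unfolding L[OF that] sum_k_fun[OF that(2)] using that idx_Lam(1)[OF that(2)]
      by (simp add: Amat_def)
    fix B assume B: "B \<in> carrier_mat (2 ^ m) (2 ^ m) \<and> (\<forall>j<2 ^ m. \<forall>x\<in>Lam.
      L_approx g (Suc m) (k_fun g (Suc m) (Suc j)) x =
        (\<Sum>i<2 ^ m. B $$ (i, j) * k_fun g (Suc m) (Suc i) x))"
    show "B = Amat m"
    proof (rule eq_matI)
      fix i j assume "i < dim_row (Amat m)" "j < dim_col (Amat m)"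
      then have ij: "i < 2 ^ m" "j < 2 ^ m" by (simp_all add: Amat_def)
      obtain x where x: "x \<in> Lam" "idx m x = i" using idx_surj[OF ij(1)] .
      have "B $$ (i, j) = op.T m (?e j) i"
        using B ij x L[OF ij(2) x(1)] sum_k_fun[OF x(1), where m = m and f = "\<lambda>i. B $$ (i, j)"] by simp
      then show "B $$ (i, j) = Amat m $$ (i, j)" using ij by (simp add: Amat_def)
    qed (use B in \<open>auto simp: Amat_def\<close>)
  qed
qed

lemma Amat_mult_vec:
  assumes t: "t \<in> carrier_vec (2 ^ m)" and i: "i < 2 ^ m"
  shows "vec_index (Amat m *\<^sub>v t) i = op.T m (vec_index t) i"
proof -
  let ?e = "\<lambda>j k. if k = j then 1 else 0 :: real" and ?N = "2 ^ m :: nat"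
  define p q where "p = (?N - 1 - i) div 2" and "q = (?N + i) div 2"
  have pq: "p < ?N" "q < ?N" using i by (auto simp: p_def q_def)
  have T: "op.T m f i = - al * f p + wt m i * f q" for f by (simp only: op.T_def p_def q_def)
  have "vec_index (Amat m *\<^sub>v t) i = (\<Sum>j<?N. op.T m (?e j) i * vec_index t j)"
    using t i by (simp add: Amat_def scalar_prod_def lessThan_atLeast0)
  also have "\<dots> = (\<Sum>j<?N. (if p = j then - al * vec_index t j else 0)
      + (if q = j then wt m i * vec_index t j else 0))"
    unfolding T by (intro sum.cong) (simp_all add: left_diff_distrib)
  also have "\<dots> = op.T m (vec_index t) i"
    unfolding sum.distrib T using pq by simp
  finally show ?thesis .
qed

lemma eigenvector_Amat_iff:
  assumes "t \<in> carrier_vec (2 ^ m)"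
  shows "eigenvector (Amat m) t \<mu> \<longleftrightarrow>
    t \<noteq> 0\<^sub>v (2 ^ m) \<and> (\<forall>i<2 ^ m. op.T m (vec_index t) i = \<mu> * vec_index t i)"
proof -
  have d: "dim_row (Amat m) = 2 ^ m" "dim_vec (Amat m *\<^sub>v t) = 2 ^ m" by (simp_all add: Amat_def)
  have "Amat m *\<^sub>v t = \<mu> \<cdot>\<^sub>v t \<longleftrightarrow> (\<forall>i<2 ^ m. vec_index (Amat m *\<^sub>v t) i = \<mu> * vec_index t i)"
    unfolding vec_eq_iff d(2) using assms by simp
  also have "\<dots> \<longleftrightarrow> (\<forall>i<2 ^ m. op.T m (vec_index t) i = \<mu> * vec_index t i)"
    using Amat_mult_vec[OF assms] by (intro all_cong) simp
  finally show ?thesis using assms unfolding eigenvector_def d(1) by blast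
qed

lemma CN_iff:
  assumes "t \<in> carrier_vec (2 ^ m)"
  shows "t \<in> CN (Suc m) \<longleftrightarrow> vec_index t \<in> op.mono_cone m"
proof
  assume t: "t \<in> CN (Suc m)"
  show "vec_index t \<in> op.mono_cone m"
    unfolding op.mono_cone_def
  proof (intro CollectI allI impI)
    fix i :: nat assume "i < 2 ^ m"
    then show "0 \<le> inc (vec_index t) i" using t by (cases i) (simp_all add: CN_def)
  qed
next
  assume t: "vec_index t \<in> op.mono_cone m"
  show "t \<in> CN (Suc m)"
    unfolding CN_def diff_Suc_1
  proof (intro CollectI conjI allI impI)
    show "t \<in> carrier_vec (2 ^ m)" by (rule assms)
    show "0 \<le> vec_index t 0" by (rule op.cone_nonneg[OF t]) simp
    show "vec_index t i \<le> vec_index t j" if "i \<le> j \<and> j < 2 ^ m" for i j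
      using that by (intro op.cone_mono[OF t]) blast+
  qed
qed

section \<open>The normalised eigenvectors and their eigenvalues\<close>

definition tv :: "nat \<Rightarrow> nat \<Rightarrow> real" where "tv m = vec_index (v_vec g (Suc m))"

abbreviation lam :: "nat \<Rightarrow> real" where "lam m \<equiv> lambda_approx g (Suc m)"

text \<open>Resolves the definite descriptions in \<open>v_vec\<close> and
  \<open>lambda_approx\<close>. The vector is unique by \<open>op.eigen_unique\<close>; its
  eigenvalue is read off the last coordinate, whose value 1 also rules out the zero vector.\<close>

lemma tv_cone: "tv m \<in> op.mono_cone m" and tv_last: "tv m (2 ^ m - 1) = 1"
    and tv_eigen: "\<And>i. i < 2 ^ m \<Longrightarrow> op.T m (tv m) i = lam m * tv m i"
proof -
  let ?N = "2 ^ m :: nat"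
  let ?P = "\<lambda>t. t \<in> CN (Suc m) \<and> vec_index t (2 ^ (Suc m - 1) - 1) = 1 \<and>
             (\<exists>\<mu>. eigenvector (A_mat g (Suc m)) t \<mu>)"
  obtain t l where t: "t \<in> op.mono_cone m" "t (?N - 1) = 1" "\<And>i. i < ?N \<Longrightarrow> op.T m t i = l * t i"
    using op.eigen_exists[where m = m] by blast
  define u where "u = vec ?N t"
  have uc: "u \<in> carrier_vec ?N" and ui: "\<And>i. i < ?N \<Longrightarrow> vec_index u i = t i" by (simp_all add: u_def)
  have P: "?P w \<longleftrightarrow> w \<in> carrier_vec ?N \<and> vec_index w \<in> op.mono_cone m \<and> vec_index w (?N - 1) = 1 \<and>
      (\<exists>\<mu>. \<forall>i<?N. op.T m (vec_index w) i = \<mu> * vec_index w i)" for w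
  proof -
    have "w \<in> CN (Suc m) \<Longrightarrow> w \<in> carrier_vec ?N" by (simp add: CN_def)
    moreover have "w \<noteq> 0\<^sub>v ?N" if "vec_index w (?N - 1) = 1" using that by auto
    ultimately show ?thesis using CN_iff[of w m] eigenvector_Amat_iff[of w m]
      unfolding A_mat_eq diff_Suc_1 by blast
  qed
  have "inc (vec_index u) i = inc t i" if "i < ?N" for i
    using ui that by (rule inc_cong)
  then have "vec_index u \<in> op.mono_cone m" using t(1) by (simp add: op.mono_cone_def)
  moreover have "vec_index u (?N - 1) = 1" using ui t(2) by simp
  moreover have Tul: "op.T m (vec_index u) i = l * vec_index u i" if i: "i < ?N" for i
    unfolding ui[OF i] t(3)[OF i, symmetric] using ui i by (rule op.T_cong)
  ultimately have Pu: "?P u" unfolding P using uc by blast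
  have "w = u" if Pw: "?P w" for w
  proof (rule eq_vecI)
    obtain \<mu> where w: "w \<in> carrier_vec ?N" "vec_index w \<in> op.mono_cone m" "vec_index w (?N - 1) = 1"
      "\<And>i. i < ?N \<Longrightarrow> op.T m (vec_index w) i = \<mu> * vec_index w i"
      using Pw unfolding P by blast
    show "dim_vec w = dim_vec u" using w uc by simp
    fix i assume "i < dim_vec u"
    then have i: "i < ?N" using uc by simp
    show "vec_index w i = vec_index u i"
      using op.eigen_unique[OF t(1,3,2) w(2,4,3) i] ui[OF i] by simp
  qed
  then have v: "v_vec g (Suc m) = u" unfolding v_vec_def by (rule the_equality[of ?P, OF Pu])
  have tvt: "tv m i = t i" if "i < ?N" for i using ui that by (simp add: tv_def v)
  have "inc (tv m) i = inc t i" if "i < ?N" for i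
    using tvt that by (rule inc_cong)
  then show "tv m \<in> op.mono_cone m" using t(1) by (simp add: op.mono_cone_def)
  show "tv m (?N - 1) = 1" using tvt t(2) by simp
  have "u \<noteq> 0\<^sub>v ?N" using ui[of "?N - 1"] t(2) by auto
  then have ev: "eigenvector (Amat m) u \<mu> \<longleftrightarrow> (\<forall>i<?N. op.T m (vec_index u) i = \<mu> * vec_index u i)" for \<mu>
    unfolding eigenvector_Amat_iff[OF uc] by blast
  have "lam m = l"
    unfolding lambda_approx_def A_mat_eq v ev
  proof (rule the_equality)
    show "\<forall>i<?N. op.T m (vec_index u) i = l * vec_index u i" using Tul by blast
    fix \<mu> assume "\<forall>i<?N. op.T m (vec_index u) i = \<mu> * vec_index u i"
    then have "op.T m (vec_index u) (?N - 1) = \<mu> * vec_index u (?N - 1)" by simp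
    then show "\<mu> = l" using Tul[of "?N - 1"] ui[of "?N - 1"] t(2) by simp
  qed
  then show "op.T m (tv m) i = lam m * tv m i" if "i < ?N" for i
    using Tul[OF that] by (simp add: tv_def v)
qed

lemma tv_bounds: "i < 2 ^ m \<Longrightarrow> 0 \<le> tv m i \<and> tv m i \<le> 1"
  using op.cone_nonneg[OF tv_cone, of i m] op.cone_mono[OF tv_cone, of i "2 ^ m - 1" m] tv_last[of m]
  by simp

lemma lam_eq: "lam m = al\<^sup>2 - al * tv m 0"
  using op.T_last[of m "tv m"] tv_eigen[of "2 ^ m - 1" m] tv_last[of m] wt_last[of m] by simp

lemma lam_ge: "al\<^sup>2 - al \<le> lam m"
  using tv_bounds[of 0 m] al_pos by (simp add: lam_eq)

abbreviation vf :: "nat \<Rightarrow> real \<Rightarrow> real" where "vf m \<equiv> v_fun g (Suc m)"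

lemma vf_eq: "x \<in> Lam \<Longrightarrow> vf m x = tv m (idx m x)"
  unfolding v_fun_def diff_Suc_1 tv_def[symmetric] by (rule sum_k_fun)

lemma vf_bounds: "x \<in> Lam \<Longrightarrow> 0 \<le> vf m x \<and> vf m x \<le> 1"
  using tv_bounds[OF idx_Lam(1)] by (simp add: vf_eq)

lemma vf_1: "vf m 1 = 1"
proof -
  have "1 \<in> piece m (2 ^ m - 1)" using hi_last[of m] ends_J[of "2 ^ m - 1" m] by (simp add: piece_def)
  then have "idx m 1 = 2 ^ m - 1" by (intro idx_eqI) auto
  then show ?thesis unfolding vf_eq[OF one_Lam] by (simp only: tv_last)
qed

lemma vf_eigen:
  "x \<in> Lam \<Longrightarrow> lam m * vf m x = - al * vf m (tau0 x) + wt m (idx m x) * vf m (tau1 x)"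
  using tv_eigen[OF idx_Lam(1)] by (simp add: vf_eq T_idx tau0_Lam tau1_Lam)

end


context concave_feigenbaum
begin

subsection \<open>The critical orbit\<close>

abbreviation orb :: "real set" where "orb \<equiv> crit_orbit g"

lemma g_range_J: "x \<in> {-1..1} \<Longrightarrow> g x \<in> feig_J g"
proof -
  assume x: "x \<in> {-1..1}"
  then have "g \<bar>x\<bar> = g x" using g_even[OF x] by (simp add: abs_if)
  moreover have "\<bar>x\<bar> \<le> 1" using x by auto
  then have "g 1 \<le> g \<bar>x\<bar>" using g_decreasing[of "\<bar>x\<bar>" 1] by (cases "\<bar>x\<bar> = 1") auto
  ultimately show "g x \<in> feig_J g" using g_maps[OF x] by (simp add: feig_J_def)
qed

lemma g_J0: "x \<in> feig_J0 g \<Longrightarrow> g x \<in> feig_J1 g"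
proof -
  assume x: "x \<in> feig_J0 g"
  then have xI: "x \<in> {-1..1}" using J0_subset_J J_subset by blast
  have e: "- 1 / al = - (1 / al)" by simp
  have "\<bar>x\<bar> \<le> 1 / al"
    using x inv_al_sq_less unfolding feig_J0_eq atLeastAtMost_iff e abs_le_iff by linarith
  then have "g (1 / al) \<le> g \<bar>x\<bar>"
    using g_decreasing[of "\<bar>x\<bar>" "1 / al"] inv_al_less_1 by (cases "\<bar>x\<bar> = 1 / al") auto
  moreover have "g \<bar>x\<bar> = g x" using g_even[OF xI] by (simp add: abs_if)
  ultimately show "g x \<in> feig_J1 g" using g_maps[OF xI] by (simp add: feig_J1_eq)
qed

lemma orbit_J: "n \<ge> 1 \<Longrightarrow> (g ^^ n) 0 \<in> feig_J g"
proof (induction n)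
  case (Suc n)
  have "(g ^^ n) 0 \<in> {-1..1}"
    using Suc J_subset by (cases "n = 0") auto
  then show ?case using g_range_J by simp
qed simp

text \<open>The fixed point equation as a semiconjugacy: \<open>tau0\<close> turns one step of g
  into two, and so doubles the time along the critical orbit.\<close>

lemma tau0_g: "x \<in> {-1..1} \<Longrightarrow> tau0 (g x) = g (g (tau0 x))"
  using g_fixed_point[of x] tau0_al(1)[of "g (g (tau0 x))"] by (simp add: tau0_def)

lemma orbit_even: "(g ^^ (2 * n)) 0 = tau0 ((g ^^ n) 0)"
proof (induction n)
  case (Suc n)
  have "(g ^^ n) 0 \<in> {-1..1}"
    using orbit_J[of n] J_subset by (cases "n = 0") auto
  then show ?case using Suc tau0_g by simp
qed (simp add: tau0_def)

text \<open>The point lies in \<open>feig_J1 g\<close>, since g maps \<open>feig_J0 g\<close> there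
  (for n = 1 it is 1 itself), and its image under g is \<open>tau0\<close> of g^n(0) by
  \<open>orbit_even\<close>. Multiplying by -\<alpha> shows that \<sigma> sends it to
  g^n(0).\<close>

lemma orbit_odd:
  assumes "n \<ge> 1"
  shows "(g ^^ (2 * n - 1)) 0 = tau1 ((g ^^ n) 0)"
proof -
  let ?y = "(g ^^ (2 * n - 1)) 0"
  obtain k where n: "n = Suc k" using assms by (cases n) auto
  have y: "?y = g (tau0 ((g ^^ k) 0))" unfolding orbit_even[symmetric] by (simp add: n)
  have J1: "?y \<in> feig_J1 g"
  proof (cases "k = 0")
    case True
    then show ?thesis using one_mem unfolding y by (simp add: tau0_def g_0)
  next
    case False
    then show ?thesis unfolding y by (intro g_J0 tau0_mem orbit_J) simp
  qed
  have "g ?y = (g ^^ (2 * n)) 0" by (simp add: n)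
  then have "sg ?y = (g ^^ n) 0"
    unfolding sigma_J1[OF J1] by (simp only: orbit_even tau0_al)
  then show ?thesis using tau1_eqI[OF J1] by simp
qed

lemma orb_J: "x \<in> orb \<Longrightarrow> x \<in> feig_J g"
  using orbit_J by (auto simp: crit_orbit_def)

lemma tau0_orb: "x \<in> orb \<Longrightarrow> tau0 x \<in> orb"
proof -
  assume "x \<in> orb"
  then obtain n where "x = (g ^^ n) 0" "n \<ge> 1" by (auto simp: crit_orbit_def)
  then show "tau0 x \<in> orb"
    unfolding crit_orbit_def using orbit_even[of n] by (intro CollectI exI[of _ "2 * n"]) simp
qed

lemma tau1_orb: "x \<in> orb \<Longrightarrow> tau1 x \<in> orb"
proof -
  assume "x \<in> orb"
  then obtain n where "x = (g ^^ n) 0" "n \<ge> 1" by (auto simp: crit_orbit_def)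
  then show "tau1 x \<in> orb"
    unfolding crit_orbit_def using orbit_odd[of n] by (intro CollectI exI[of _ "2 * n - 1"]) simp
qed

lemma one_orb: "1 \<in> orb"
  unfolding crit_orbit_def using g_0 by (intro CollectI exI[of _ 1]) simp

lemma g_1_orb: "g 1 \<in> orb"
  unfolding crit_orbit_def using g_0 by (intro CollectI exI[of _ 2]) (simp add: eval_nat_numeral)

lemma orb_sigma:
  assumes "x \<in> orb"
  shows "x \<in> feig_dom g" "sg x \<in> orb"
proof -
  obtain n where n: "x = (g ^^ n) 0" "n \<ge> 1" using assms by (auto simp: crit_orbit_def)
  obtain y where "y \<in> orb" "x = tau0 y \<or> x = tau1 y"
  proof (cases "even n")
    case True
    then obtain k where k: "n = 2 * k" by blast
    show ?thesis
    proof (rule that)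
      show "(g ^^ k) 0 \<in> orb" using k n by (auto simp: crit_orbit_def)
      show "x = tau0 ((g ^^ k) 0) \<or> x = tau1 ((g ^^ k) 0)" using n k orbit_even by simp
    qed
  next
    case False
    then obtain k where "n = 2 * k + 1" by (blast elim: oddE)
    then have k: "n = 2 * Suc k - 1" by simp
    show ?thesis
    proof (rule that)
      show "(g ^^ Suc k) 0 \<in> orb" by (auto simp: crit_orbit_def intro!: exI[of _ "Suc k"])
      show "x = tau0 ((g ^^ Suc k) 0) \<or> x = tau1 ((g ^^ Suc k) 0)"
        using orbit_odd[of "Suc k"] unfolding n(1) k by simp
    qed
  qed
  then show "x \<in> feig_dom g" "sg x \<in> orb"
    using orb_J[of y] tau0_mem tau1_mem sigma_tau0 sigma_tau1 by (auto simp: feig_dom_def)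
qed

lemma orb_Lam: "orb \<subseteq> Lam"
proof
  fix x assume x: "x \<in> orb"
  have "(sg ^^ n) x \<in> orb" for n using x orb_sigma(2) by (induction n) auto
  then show "x \<in> Lam" using orb_sigma(1) by (simp add: feig_Lambda_def)
qed

lemma orb_meets_piece: "j < 2 ^ n \<Longrightarrow> \<exists>x\<in>orb. x \<in> piece n j"
  by (rule piece_meets_backward_invariant[OF one_orb]) (use orb_J tau0_orb tau1_orb in blast)+

lemma orb_countable: "countable orb"
proof -
  have "orb \<subseteq> range (\<lambda>n. (g ^^ n) 0)" by (auto simp: crit_orbit_def)
  then show ?thesis by (rule countable_subset) simp
qed


subsection \<open>Oscillation on pieces\<close>

lemma piece_idx_antimono:
  assumes "x \<in> Lam" "k \<le> m"
  shows "piece m (idx m x) \<subseteq> piece k (idx k x)"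
  using assms(2)
proof (induction m rule: dec_induct)
  case (step m)
  then show ?case
    using piece_parent[OF idx_Lam(1)[OF assms(1)], of m] idx_Suc_div_2[OF assms(1), of m] by simp
qed simp

lemma piece_dist:
  assumes "j < 2 ^ n" "x \<in> piece n j" "y \<in> piece n j"
  shows "\<bar>x - y\<bar> \<le> 2 / al ^ n"
  using assms piece_length[OF assms(1)] by (auto simp: piece_def)

lemma lo_0: "lo n 0 = g 1"
proof (cases n)
  case (Suc m)
  then show ?thesis using hi_last[of m] by (simp add: tau0_def g_1)
qed simp

text \<open>Downward induction on the level \<open>k\<close>, starting at \<open>k = m\<close> where the eigenfunction is constant on
  pieces. On each of the two inverse branches the weight times the length of the image piece is at
  most the length of the piece (for \<open>tau1\<close> because \<open>g\<close> is concave and the weight is taken at the left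
  end, up to a Lipschitz error), so the bound reproduces itself since the eigenvalue exceeds \<open>2\<close>.\<close>

lemma vf_oscillation:
  obtains C where "C \<ge> 0" and "\<And>m k j x y. k \<le> m \<Longrightarrow> j < 2 ^ k \<Longrightarrow> x \<in> Lam \<inter> piece k j \<Longrightarrow>
    y \<in> Lam \<inter> piece k j \<Longrightarrow> vf m y - vf m x \<le> C * (hi k j - lo k j)"
proof -
  obtain K where K: "K \<ge> 0"
    and lip: "\<And>x y. x \<in> {-1..1} \<Longrightarrow> y \<in> {-1..1} \<Longrightarrow> \<bar>g' x - g' y\<bar> \<le> K * \<bar>x - y\<bar>"
    using g'_Lipschitz by blast
  have "0 < (al - 2) * (al + 1)" using al_gt_2 by simp
  then have den: "0 < al\<^sup>2 - al - 2" by (simp add: algebra_simps power2_eq_square)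
  \<comment> \<open>The constant that exactly reproduces itself under the estimate below: it solves
    \<open>2 * C + 2 * K = (al\<^sup>2 - al) * C\<close>.\<close>
  define C where "C = 2 * K / (al\<^sup>2 - al - 2)"
  have C: "C \<ge> 0" using K den by (simp add: C_def)
  have "C * (al\<^sup>2 - al - 2) = 2 * K" using den by (simp add: C_def)
  then have C_eq: "2 * C + 2 * K = (al\<^sup>2 - al) * C" by (simp add: algebra_simps)
  have "\<forall>j<2 ^ k. \<forall>x\<in>Lam \<inter> piece k j. \<forall>y\<in>Lam \<inter> piece k j. vf m y - vf m x \<le> C * (hi k j - lo k j)"
    if "k \<le> m" for k m
    using that
  proof (induction rule: inc_induct)
    case base
    show ?case
    proof (intro allI impI ballI)
      fix j x y assume j: "j < 2 ^ m" and x: "x \<in> Lam \<inter> piece m j" and y: "y \<in> Lam \<inter> piece m j"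
      have "idx m x = j" "idx m y = j" using idx_eqI[OF j] x y by blast+
      then have "vf m y = vf m x" using x y by (simp add: vf_eq)
      moreover have "0 \<le> C * (hi m j - lo m j)" using C ends_J[OF j] by (intro mult_nonneg_nonneg) auto
      ultimately show "vf m y - vf m x \<le> C * (hi m j - lo m j)" by linarith
    qed
  next
    case (step k)
    show ?case
    proof (intro allI impI ballI)
      fix j x y assume j: "j < 2 ^ k" and x': "x \<in> Lam \<inter> piece k j" and y': "y \<in> Lam \<inter> piece k j"
      then have x: "x \<in> Lam" "x \<in> piece k j" "x \<in> feig_J g" and y: "y \<in> Lam" "y \<in> piece k j" "y \<in> feig_J g"
        using Lam_J by blast+
      define len where "len = hi k j - lo k j"
      define l1 h1 where "l1 = tau1 (lo k j)" and "h1 = tau1 (hi k j)"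
      define d where "d = h1 - l1"
      define p where "p = - al * g' l1"
      have len: "0 \<le> len" using ends_J[OF j] by (simp add: len_def)
      have e: "lo k j \<in> feig_J g" "hi k j \<in> feig_J g" "lo k j \<le> hi k j" using ends_J[OF j] by auto
      have l1: "l1 \<in> feig_J1 g" and h1: "h1 \<in> feig_J1 g" and lh: "l1 \<le> h1"
        using e tau1_mem tau1_le_iff by (auto simp: l1_def h1_def)
      have d0: "0 \<le> d" using lh by (simp add: d_def)
      have sg_len: "sg h1 - sg l1 = len" using e by (simp add: l1_def h1_def sigma_tau1 len_def)
      have ald: "al * d \<le> len" using sigma_expanding_J1[OF l1 h1 lh] by (simp add: sg_len d_def)
      have pd: "p * d \<le> len" using sigma_slope_J1[OF l1 h1] by (simp add: sg_len d_def p_def)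
      have p: "0 \<le> p" using g'_J1_less[OF l1] al_pos
        unfolding p_def by (simp add: mult_nonneg_nonpos2 mult_le_0_iff)
      let ?P0 = "2 ^ k - 1 - j" and ?P1 = "2 ^ k + j"
      have i: "?P0 < 2 ^ Suc k" "?P1 < 2 ^ Suc k" using j by auto
      have "hi (Suc k) ?P0 - lo (Suc k) ?P0 = len / al"
        using j by (simp add: length_tau0 len_def)
      moreover have "tau0 x \<in> Lam \<inter> piece (Suc k) ?P0" "tau0 y \<in> Lam \<inter> piece (Suc k) ?P0"
        by (intro IntI tau0_Lam tau0_piece x y j)+
      \<comment> \<open>The roles of \<open>x\<close> and \<open>y\<close> are exchanged because the
        left branch enters with the negative weight -\<alpha>.\<close>
      ultimately have o0: "vf m (tau0 x) - vf m (tau0 y) \<le> C * (len / al)"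
        using step.IH[rule_format, OF i(1), of "tau0 y" "tau0 x"] by (simp only:)
      have P1: "lo (Suc k) ?P1 = l1" "hi (Suc k) ?P1 = h1" by (simp_all add: l1_def h1_def)
      have "tau1 x \<in> Lam \<inter> piece (Suc k) ?P1" "tau1 y \<in> Lam \<inter> piece (Suc k) ?P1"
        by (intro IntI tau1_Lam tau1_piece x y j)+
      then have o1: "vf m (tau1 y) - vf m (tau1 x) \<le> C * d"
        using step.IH[rule_format, OF i(2), of "tau1 x" "tau1 y"] by (simp only: P1 d_def)
      \<comment> \<open>Each weight is -\<alpha> g' at the right end of a subpiece lying between
        \<open>l1\<close> and \<open>h1\<close>, and \<open>p\<close> is the same expression at
        \<open>l1\<close>. All of them thus differ by at most \<alpha> K times the length
        \<open>d\<close>.\<close>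
      have wt: "\<bar>wt m (idx m z) - wt m (idx m z')\<bar> \<le> al * K * d \<and> \<bar>wt m (idx m z) - p\<bar> \<le> al * K * d
          \<and> 0 \<le> wt m (idx m z)"
        if z: "z \<in> Lam" "z \<in> piece k j" and z': "z' \<in> Lam" "z' \<in> piece k j" for z z'
      proof -
        have b: "hi (Suc m) (2 ^ m + idx m z) \<in> {l1..h1}" if z: "z \<in> Lam" "z \<in> piece k j" for z
        proof -
          have "idx k z = j" using idx_eqI[OF j] z by blast
          then have "piece (Suc m) (2 ^ m + idx m z) \<subseteq> piece (Suc k) ?P1"
            using piece_idx_antimono[OF tau1_Lam[OF z(1)], of "Suc k" "Suc m"] step.hyps
            by (simp add: idx_tau1[OF z(1)])
          moreover have "hi (Suc m) (2 ^ m + idx m z) \<in> piece (Suc m) (2 ^ m + idx m z)"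
            using ends_J[of "2 ^ m + idx m z" "Suc m"] idx_Lam(1)[OF z(1), of m] by (simp add: piece_def)
          ultimately show ?thesis unfolding piece_def P1[symmetric] by blast
        qed
        have dist: "\<bar>- al * g' u - - al * g' v\<bar> \<le> al * K * d" if "u \<in> {l1..h1}" "v \<in> {l1..h1}" for u v
        proof -
          have "u \<in> {-1..1}" "v \<in> {-1..1}" using J1_bounds[OF l1] J1_bounds[OF h1] that by auto
          then have "\<bar>g' u - g' v\<bar> \<le> K * \<bar>u - v\<bar>" by (rule lip)
          also have "\<dots> \<le> K * d" using that K by (intro mult_left_mono) (auto simp: d_def)
          finally have "al * \<bar>g' u - g' v\<bar> \<le> al * (K * d)" using al_pos by (intro mult_left_mono) auto
          moreover have "\<bar>- al * g' u - - al * g' v\<bar> = al * \<bar>g' u - g' v\<bar>"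
          proof -
            have "- al * g' u - - al * g' v = al * (g' v - g' u)" by (simp add: algebra_simps)
            then show ?thesis using al_pos by (simp add: abs_mult abs_minus_commute)
          qed
          ultimately show ?thesis by (simp add: mult.assoc)
        qed
        have "l1 \<in> {l1..h1}" using lh by simp
        moreover have "0 < wt m (idx m z)" using op.c_pos[OF idx_Lam(1)[OF z(1), of m]] .
        ultimately show ?thesis
          unfolding wt_def p_def using dist[OF b[OF z] b[OF z']] dist[OF b[OF z], of l1]
          by (simp add: less_imp_le)
      qed
      define ax ay D v1 where "ax = wt m (idx m x)" and "ay = wt m (idx m y)"
        and "D = vf m (tau1 y) - vf m (tau1 x)" and "v1 = vf m (tau1 y)"
      have v1: "0 \<le> v1" "v1 \<le> 1" and D1: "D \<le> 1"
        using vf_bounds[OF tau1_Lam[OF x(1)], of m] vf_bounds[OF tau1_Lam[OF y(1)], of m]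
        by (auto simp: v1_def D_def)
      \<comment> \<open>Product rule for differences: \<open>ax * D\<close> carries the oscillation
        at the next level, the other term the variation of the weight.\<close>
      have e1: "ay * v1 - ax * vf m (tau1 x) = ax * D + (ay - ax) * v1"
        by (simp add: D_def v1_def algebra_simps)
      have Kd: "0 \<le> al * K * d" using K d0 al_pos by simp
      have "(ay - ax) * v1 \<le> (al * K * d) * v1"
        using wt[OF y(1,2) x(1,2)] v1 by (intro mult_right_mono) (auto simp: ax_def ay_def)
      also have "\<dots> \<le> (al * K * d) * 1" using Kd v1 by (intro mult_left_mono) auto
      finally have e2: "(ay - ax) * v1 \<le> al * K * d" by simp
      \<comment> \<open>For positive \<open>D\<close>, the main part \<open>p\<close> of the weight
        is combined with the inductive bound on \<open>D\<close>, and the error part with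
        \<open>D \<le> 1\<close>. Using the inductive bound for the error as well would produce a
        term quadratic in the length.\<close>
      have e3: "ax * D \<le> C * len + al * K * d"
      proof (cases "D \<le> 0")
        case True
        then have "ax * D \<le> 0" using wt[OF x(1,2) x(1,2)] by (simp add: ax_def mult_nonneg_nonpos)
        moreover have "0 \<le> C * len" using C len by simp
        ultimately show ?thesis using Kd by linarith
      next
        case False
        have "ax \<le> p + al * K * d" using wt[OF x(1,2) x(1,2)] by (auto simp: ax_def)
        then have "ax * D \<le> (p + al * K * d) * D" using False by (intro mult_right_mono) auto
        also have "\<dots> = p * D + (al * K * d) * D" by (simp add: distrib_right)
        also have "(al * K * d) * D \<le> (al * K * d) * 1" using Kd D1 by (intro mult_left_mono) auto
        also have "p * D \<le> p * (C * d)" using p o1 by (intro mult_left_mono) (auto simp: D_def)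
        also have "p * (C * d) = C * (p * d)" by simp
        also have "C * (p * d) \<le> C * len" using pd C by (intro mult_left_mono)
        finally show ?thesis by simp
      qed
      have e4: "al * (vf m (tau0 x) - vf m (tau0 y)) \<le> C * len"
      proof -
        have "al * (vf m (tau0 x) - vf m (tau0 y)) \<le> al * (C * (len / al))"
          using o0 al_pos by (intro mult_left_mono) auto
        then show ?thesis using al_nz by simp
      qed
      have "K * (al * d) \<le> K * len" using ald K by (intro mult_left_mono)
      then have e5: "al * K * d \<le> K * len" by (simp add: mult_ac)
      have "lam m * (vf m y - vf m x) = al * (vf m (tau0 x) - vf m (tau0 y)) + (ay * v1 - ax * vf m (tau1 x))"
        unfolding right_diff_distrib vf_eigen[OF x(1)] vf_eigen[OF y(1)]
        by (simp add: ax_def ay_def v1_def)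
      also have "\<dots> \<le> 2 * (C * len) + 2 * (K * len)" using e1 e2 e3 e4 e5 by linarith
      also have "\<dots> = (2 * C + 2 * K) * len" by (simp add: distrib_right)
      also have "\<dots> = (al\<^sup>2 - al) * (C * len)" by (simp only: C_eq mult.assoc)
      also have "\<dots> \<le> lam m * (C * len)" using lam_ge C len by (intro mult_right_mono) auto
      finally have "lam m * (vf m y - vf m x) \<le> lam m * (C * len)" .
      moreover have "0 < lam m" using lam_ge[of m] den by linarith
      ultimately show "vf m y - vf m x \<le> C * (hi k j - lo k j)" by (simp add: len_def)
    qed
  qed
  then show ?thesis using that[OF C] by blast
qed

section \<open>A modulus of continuity independent of the approximation\<close>

definition nullbound :: "real \<Rightarrow> nat \<Rightarrow> real" where "nullbound C k = C * (2 / al ^ k)"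

lemma nullbound_tendsto: "nullbound C \<longlonglongrightarrow> 0"
proof -
  have "(\<lambda>k. C * 2 * (inverse al) ^ k) \<longlonglongrightarrow> C * 2 * 0"
    using al_gt_1 by (intro tendsto_mult tendsto_const LIMSEQ_power_zero) (simp add: inverse_less_1_iff)
  then show ?thesis by (simp add: nullbound_def[abs_def] power_inverse divide_inverse mult.assoc)
qed

lemma vf_uniform_oscillation:
  obtains C where "\<And>m k x y. k \<le> m \<Longrightarrow> x \<in> Lam \<Longrightarrow> y \<in> Lam \<Longrightarrow> idx k x = idx k y \<Longrightarrow>
    \<bar>vf m x - vf m y\<bar> \<le> nullbound C k"
proof -
  obtain C where C: "C \<ge> 0" "\<And>m k j x y. k \<le> m \<Longrightarrow> j < 2 ^ k \<Longrightarrow> x \<in> Lam \<inter> piece k j \<Longrightarrow>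
    y \<in> Lam \<inter> piece k j \<Longrightarrow> vf m y - vf m x \<le> C * (hi k j - lo k j)"
    using vf_oscillation by blast
  have "\<bar>vf m x - vf m y\<bar> \<le> nullbound C k"
    if k: "k \<le> m" and x: "x \<in> Lam" and y: "y \<in> Lam" and xy: "idx k x = idx k y" for m k x y
  proof -
    let ?j = "idx k x"
    have j: "?j < 2 ^ k" and p: "x \<in> Lam \<inter> piece k ?j" "y \<in> Lam \<inter> piece k ?j"
      using idx_Lam[OF x, of k] idx_Lam[OF y, of k] x y xy by auto
    have "\<bar>vf m x - vf m y\<bar> \<le> C * (hi k ?j - lo k ?j)"
      using C(2)[OF k j p] C(2)[OF k j p(2,1)] by linarith
    also have "\<dots> \<le> nullbound C k"
      unfolding nullbound_def using C(1) piece_length[OF j] by (intro mult_left_mono)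
    finally show ?thesis .
  qed
  then show ?thesis using that by blast
qed

text \<open>The remaining pieces of level \<open>k\<close> form a closed set avoiding
  \<open>x\<close>. This turns oscillation bounds on pieces into continuity on
  \<open>feig_Lambda g\<close>.\<close>

lemma idx_locally_constant:
  assumes x: "x \<in> Lam"
  obtains e where "e > 0" "\<And>y. y \<in> Lam \<Longrightarrow> dist y x < e \<Longrightarrow> idx k y = idx k x"
proof -
  let ?U = "\<Union>j\<in>{..<2 ^ k} - {idx k x}. piece k j"
  have "closed ?U" by (intro closed_UN) (auto simp: piece_def)
  moreover have "x \<notin> ?U" using idx_eqI[of _ k x] by auto
  ultimately have "open (- ?U)" "x \<in> - ?U" by (simp_all only: open_Compl Compl_iff not_False_eq_True)
  then obtain e where e: "e > 0" "ball x e \<subseteq> - ?U" by (rule openE)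
  have "idx k y = idx k x" if y: "y \<in> Lam" "dist y x < e" for y
  proof -
    have "y \<notin> ?U" using e(2) y(2) by (auto simp: dist_commute)
    then show ?thesis using idx_Lam[OF y(1), of k] by blast
  qed
  then show ?thesis using that e(1) by blast
qed

text \<open>Both \<open>c k\<close> and \<open>x\<close> lie in one piece of level \<open>k\<close>,
  whose length is at most \<open>2 / al ^ k\<close>.\<close>

lemma idx_approx_tendsto:
  assumes x: "x \<in> Lam" and c: "\<And>k. c k \<in> piece k (idx k x)"
  shows "c \<longlonglongrightarrow> x"
proof (rule LIMSEQ_I)
  fix r :: real assume "r > 0"
  then obtain N where N: "\<And>k. k \<ge> N \<Longrightarrow> norm (nullbound 1 k - 0) < r"
    using LIMSEQ_D[OF nullbound_tendsto] by blast
  have "norm (c k - x) < r" if "k \<ge> N" for k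
  proof -
    have "\<bar>c k - x\<bar> \<le> nullbound 1 k"
      using piece_dist[OF idx_Lam(1)[OF x] c[of k] idx_Lam(2)[OF x]] by (simp add: nullbound_def)
    then show ?thesis using N[OF that] by simp
  qed
  then show "\<exists>N. \<forall>k\<ge>N. norm (c k - x) < r" by blast
qed

section \<open>The derivative of the expanding map and the limit of the weights\<close>

text \<open>The derivative is taken within the union of two separated intervals; near
  \<open>x\<close> only the interval containing it matters, which gives uniqueness of the derivative
  also at its endpoints.\<close>

lemma feig_phi_J0:
  assumes x: "x \<in> feig_J0 g"
  shows "feig_phi g x = - al"
proof -
  have "- 1 / al < 0" "0 < 1 / al\<^sup>2" using al_pos by simp_all
  then have ab: "- 1 / al < 1 / al\<^sup>2" by (rule less_trans)
  have at: "at x within feig_dom g = at x within feig_J0 g"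
  proof (rule at_within_nhd)
    show "x \<in> {..<g (1 / al)}" using J0_less_J1[OF x c3_J1] by simp
    show "feig_dom g \<inter> {..<g (1 / al)} - {x} = feig_J0 g \<inter> {..<g (1 / al)} - {x}"
      by (auto simp: feig_dom_def feig_J1_eq)
  qed simp
  have "((\<lambda>x. - al * x) has_vector_derivative - al) (at x within feig_J0 g)"
    unfolding has_real_derivative_iff_has_vector_derivative[symmetric]
    by (auto intro!: derivative_eq_intros)
  then have "(sg has_vector_derivative - al) (at x within feig_J0 g)"
    by (rule has_vector_derivative_transform[OF x, rotated]) (rule sigma_J0)
  then show ?thesis
    unfolding feig_phi_def at unfolding feig_J0_eq
    by (rule vector_derivative_within_closed_interval[OF ab x[unfolded feig_J0_eq]])
qed

lemma feig_phi_J1: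
  assumes x: "x \<in> feig_J1 g"
  shows "feig_phi g x = - al * g' x"
proof -
  have at: "at x within feig_dom g = at x within feig_J1 g"
  proof (rule at_within_nhd)
    have "1 / al\<^sup>2 < g (1 / al)" using inv_al_sq_less g_inv_al_bounds by linarith
    then show "x \<in> {1 / al\<^sup>2<..}" using J1_bounds[OF x] by auto
    show "feig_dom g \<inter> {1 / al\<^sup>2<..} - {x} = feig_J1 g \<inter> {1 / al\<^sup>2<..} - {x}"
      by (auto simp: feig_dom_def feig_J0_eq)
  qed simp
  have "(g has_real_derivative g' x) (at x within feig_J1 g)"
    by (rule has_field_derivative_subset[OF g_deriv]) (use J1_bounds x in blast)+
  then have "((\<lambda>x. - al * g x) has_vector_derivative - al * g' x) (at x within feig_J1 g)"
    unfolding has_real_derivative_iff_has_vector_derivative[symmetric] by (rule DERIV_cmult)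
  then have "(sg has_vector_derivative - al * g' x) (at x within feig_J1 g)"
    by (rule has_vector_derivative_transform[OF x, rotated]) (rule sigma_J1)
  then show ?thesis
    unfolding feig_phi_def at unfolding feig_J1_eq
    by (rule vector_derivative_within_closed_interval[OF g_inv_al_bounds(2) x[unfolded feig_J1_eq]])
qed

text \<open>The weight is -\<alpha> g' at the right end of the piece of level \<open>Suc m\<close>
  containing \<open>tau1 x\<close>. These pieces shrink to the point, and g' is continuous.\<close>

lemma wt_tendsto:
  assumes x: "x \<in> Lam"
  shows "(\<lambda>m. wt m (idx m x)) \<longlonglongrightarrow> feig_phi g (tau1 x)"
proof -
  have t1: "tau1 x \<in> feig_J1 g" by (rule tau1_mem[OF Lam_J[OF x]])
  let ?b = "\<lambda>k. hi k (idx k (tau1 x))"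
  have "?b k \<in> piece k (idx k (tau1 x))" for k
    using ends_J[OF idx_Lam(1)[OF tau1_Lam[OF x], of k]] by (simp add: piece_def)
  then have "?b \<longlonglongrightarrow> tau1 x" by (rule idx_approx_tendsto[OF tau1_Lam[OF x]])
  then have "(\<lambda>m. ?b (Suc m)) \<longlonglongrightarrow> tau1 x" by (rule LIMSEQ_Suc)
  then have lim: "(\<lambda>m. hi (Suc m) (2 ^ m + idx m x)) \<longlonglongrightarrow> tau1 x" by (simp only: idx_tau1[OF x])
  have "(\<lambda>m. g' (hi (Suc m) (2 ^ m + idx m x))) \<longlonglongrightarrow> g' (tau1 x)"
  proof (rule continuous_on_tendsto_compose[OF real_analytic_on_imp_continuous_on[OF g'_analytic] lim])
    show "tau1 x \<in> {-1..1}" using J1_bounds[OF t1] by blast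
    show "\<forall>\<^sub>F m in sequentially. hi (Suc m) (2 ^ m + idx m x) \<in> {-1..1}"
      by (intro always_eventually allI) (use J1_bounds[OF hi_Suc_J1[OF idx_Lam(1)[OF x]]] in blast)
  qed
  then show ?thesis unfolding wt_def feig_phi_J1[OF t1] by (intro tendsto_mult tendsto_const)
qed


subsection \<open>The limit eigenfunction\<close>

text \<open>Diagonal selection gives convergence on the countable orbit. For any other point of
  \<open>feig_Lambda g\<close>, an orbit point in the same piece of high level reduces the Cauchy
  property to that of the orbit point by an e/3 argument.\<close>

lemma vf_convergent_subsequence:
  obtains r where "strict_mono (r :: nat \<Rightarrow> nat)" "\<And>x. x \<in> Lam \<Longrightarrow> convergent (\<lambda>i. vf (r i) x)"
proof -
  have bnd: "norm (vf n x) \<le> 1" if "x \<in> orb" for n x using vf_bounds[of x n] orb_Lam that by auto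
  obtain r where r: "strict_mono (r :: nat \<Rightarrow> nat)" "\<And>x. x \<in> orb \<Longrightarrow> \<exists>l. (\<lambda>n. vf (r n) x) \<longlonglongrightarrow> l"
    by (rule function_convergent_subsequence[of orb vf 1, OF orb_countable bnd]) blast+
  obtain C where C: "\<And>m k x y. k \<le> m \<Longrightarrow> x \<in> Lam \<Longrightarrow> y \<in> Lam \<Longrightarrow> idx k x = idx k y \<Longrightarrow>
    \<bar>vf m x - vf m y\<bar> \<le> nullbound C k"
    using vf_uniform_oscillation by blast
  have "Cauchy (\<lambda>i. vf (r i) x)" if x: "x \<in> Lam" for x
  proof (rule CauchyI)
    fix e :: real assume "e > 0"
    then have "e / 3 > 0" by simp
    then obtain k where k: "norm (nullbound C k - 0) < e / 3"
      using LIMSEQ_D[OF nullbound_tendsto, of "e / 3" C] by blast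
    obtain c where c: "c \<in> orb" "c \<in> piece k (idx k x)" using orb_meets_piece[OF idx_Lam(1)[OF x]] by blast
    then have cL: "c \<in> Lam" "idx k x = idx k c"
      using orb_Lam idx_eqI[OF idx_Lam(1)[OF x] c(2)] by auto
    have "convergent (\<lambda>n. vf (r n) c)" using r(2)[OF c(1)] by (simp add: convergent_def)
    then have "Cauchy (\<lambda>n. vf (r n) c)" by (rule convergent_Cauchy)
    then obtain M where M: "\<And>m n. m \<ge> M \<Longrightarrow> n \<ge> M \<Longrightarrow> norm (vf (r m) c - vf (r n) c) < e / 3"
      using CauchyD[OF _ \<open>e / 3 > 0\<close>] by blast
    \<comment> \<open>The oscillation bound of level \<open>k\<close> applies to
      \<open>vf (r m)\<close> because \<open>k \<le> m \<le> r m\<close>.\<close>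
    have close: "\<bar>vf (r m) x - vf (r m) c\<bar> < e / 3" if "m \<ge> k" for m
      using C[OF order_trans[OF that seq_suble[OF r(1)]] x cL] k by auto
    have "norm (vf (r m) x - vf (r n) x) < e" if "m \<ge> max M k" "n \<ge> max M k" for m n
    proof -
      have "\<bar>vf (r m) x - vf (r m) c\<bar> < e / 3" "\<bar>vf (r n) x - vf (r n) c\<bar> < e / 3"
        "\<bar>vf (r m) c - vf (r n) c\<bar> < e / 3"
        using close[of m] close[of n] M[of m n] that by simp_all
      then show ?thesis unfolding real_norm_def abs_less_iff by linarith
    qed
    then show "\<exists>M. \<forall>m\<ge>M. \<forall>n\<ge>M. norm (vf (r m) x - vf (r n) x) < e" by blast
  qed
  then show ?thesis using that[OF r(1)] by (simp add: Cauchy_convergent_iff)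
qed

text \<open>The eigenvalue is a function of the value at \<open>g 1\<close>, a point of the critical
  orbit, so it converges along the same subsequence.\<close>

lemma lam_eq_vf: "lam m = al\<^sup>2 - al * vf m (g 1)"
proof -
  have "g 1 \<in> piece m 0" using lo_0[of m] ends_J[of 0 m] by (simp add: piece_def)
  then have "idx m (g 1) = 0" by (intro idx_eqI) auto
  then show ?thesis using orb_Lam g_1_orb by (simp add: lam_eq vf_eq subset_iff)
qed

lemma eigenfunction_exists:
  "\<exists>(r :: nat \<Rightarrow> nat) (\<mu> :: real) (v :: real \<Rightarrow> real).
     strict_mono r \<and> (\<forall>i. r i \<ge> 1) \<and>
     (\<lambda>i. lambda_approx g (r i)) \<longlonglongrightarrow> \<mu> \<and>
     (\<forall>a \<in> crit_orbit g. (\<lambda>i. v_fun g (r i) a) \<longlonglongrightarrow> v a) \<and>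
     (\<exists>w :: real \<Rightarrow> real.
        continuous_on (feig_Lambda g) w \<and> (\<forall>a \<in> crit_orbit g. w a = v a) \<and>
        (\<forall>u. continuous_on (feig_Lambda g) u \<and> (\<forall>a \<in> crit_orbit g. u a = v a) \<longrightarrow>
             (\<forall>x \<in> feig_Lambda g. u x = w x)) \<and>
        field_eigenvector g (L_phi_B g) w \<mu>)"
proof -
  obtain r where r: "strict_mono (r :: nat \<Rightarrow> nat)" "\<And>x. x \<in> Lam \<Longrightarrow> convergent (\<lambda>i. vf (r i) x)"
    using vf_convergent_subsequence by blast
  define w where "w x = lim (\<lambda>i. vf (r i) x)" for x
  have w: "(\<lambda>i. vf (r i) x) \<longlonglongrightarrow> w x" if "x \<in> Lam" for x
    using r(2)[OF that] unfolding w_def by (rule convergent_LIMSEQ_iff[THEN iffD1])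
  define \<mu> where "\<mu> = al\<^sup>2 - al * w (g 1)"
  have mu: "(\<lambda>i. lam (r i)) \<longlonglongrightarrow> \<mu>"
    unfolding lam_eq_vf \<mu>_def using g_1_orb orb_Lam by (intro tendsto_intros w) auto
  obtain C where C: "\<And>m k x y. k \<le> m \<Longrightarrow> x \<in> Lam \<Longrightarrow> y \<in> Lam \<Longrightarrow> idx k x = idx k y \<Longrightarrow>
    \<bar>vf m x - vf m y\<bar> \<le> nullbound C k"
    using vf_uniform_oscillation by blast
  have osc: "\<bar>w x - w y\<bar> \<le> nullbound C k" if xy: "x \<in> Lam" "y \<in> Lam" "idx k x = idx k y" for k x y
  proof (rule tendsto_upperbound)
    show "(\<lambda>i. \<bar>vf (r i) x - vf (r i) y\<bar>) \<longlonglongrightarrow> \<bar>w x - w y\<bar>"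
      by (intro tendsto_intros w xy)
    show "\<forall>\<^sub>F i in sequentially. \<bar>vf (r i) x - vf (r i) y\<bar> \<le> nullbound C k"
      unfolding eventually_sequentially
      using C[OF order_trans[OF _ seq_suble[OF r(1)]] xy] by blast
  qed simp
  have cont: "continuous_on Lam w"
    unfolding continuous_on_iff
  proof (intro ballI allI impI)
    fix x e :: real assume x: "x \<in> Lam" and "e > 0"
    then obtain k where k: "norm (nullbound C k - 0) < e"
      using LIMSEQ_D[OF nullbound_tendsto] by blast
    obtain d where d: "d > 0" "\<And>y. y \<in> Lam \<Longrightarrow> dist y x < d \<Longrightarrow> idx k y = idx k x"
      using idx_locally_constant[OF x] by blast
    have "dist (w y) (w x) < e" if "y \<in> Lam" "dist y x < d" for y
      using osc[OF that(1) x d(2)[OF that]] k unfolding dist_real_def by auto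
    then show "\<exists>d>0. \<forall>y\<in>Lam. dist y x < d \<longrightarrow> dist (w y) (w x) < e" using d(1) by blast
  qed
  \<comment> \<open>The critical orbit is dense in \<open>feig_Lambda g\<close>: orbit points taken
    from the pieces around \<open>x\<close> converge to \<open>x\<close>, so a continuous extension
    is determined by its values there.\<close>
  have uniq: "u x = w x" if u: "continuous_on Lam u" "\<forall>a\<in>orb. u a = w a" and x: "x \<in> Lam" for u x
  proof -
    have "\<forall>k. \<exists>c. c \<in> orb \<and> c \<in> piece k (idx k x)" using orb_meets_piece[OF idx_Lam(1)[OF x]] by blast
    then obtain c where c: "\<And>k. c k \<in> orb" "\<And>k. c k \<in> piece k (idx k x)" by metis
    have cx: "c \<longlonglongrightarrow> x" by (rule idx_approx_tendsto[OF x c(2)])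
    have cL: "\<forall>\<^sub>F k in sequentially. c k \<in> Lam" using c(1) orb_Lam by (intro always_eventually) blast
    have "(\<lambda>k. u (c k)) \<longlonglongrightarrow> u x" by (rule continuous_on_tendsto_compose[OF u(1) cx x cL])
    moreover have "(\<lambda>k. w (c k)) \<longlonglongrightarrow> w x" by (rule continuous_on_tendsto_compose[OF cont cx x cL])
    moreover have "(\<lambda>k. u (c k)) = (\<lambda>k. w (c k))" using u(2) c(1) by auto
    ultimately show ?thesis using LIMSEQ_unique by metis
  qed
  have wb: "0 \<le> w x \<and> w x \<le> 1" if "x \<in> Lam" for x
    using tendsto_lowerbound[OF w[OF that], of 0] tendsto_upperbound[OF w[OF that], of 1] vf_bounds[OF that]
    by simp
  have "w 1 = 1" using w[OF one_Lam] by (simp add: vf_1 LIMSEQ_const_iff)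
  have eig: "L_phi_B g w x = \<mu> * w x" if x: "x \<in> Lam" for x
  proof -
    have J: "x \<in> feig_J g" by (rule Lam_J[OF x])
    have "(\<lambda>i. wt (r i) (idx (r i) x)) \<longlonglongrightarrow> feig_phi g (tau1 x)"
      using LIMSEQ_subseq_LIMSEQ[OF wt_tendsto[OF x] r(1)] by (simp add: o_def)
    then have "(\<lambda>i. - al * vf (r i) (tau0 x) + wt (r i) (idx (r i) x) * vf (r i) (tau1 x))
        \<longlonglongrightarrow> - al * w (tau0 x) + feig_phi g (tau1 x) * w (tau1 x)"
      by (intro tendsto_add tendsto_mult tendsto_const w tau0_Lam tau1_Lam x)
    then have "(\<lambda>i. lam (r i) * vf (r i) x) \<longlonglongrightarrow> L_phi_B g w x"
      unfolding vf_eigen[OF x] L_phi_B_def transfer_op_eq[OF J] feig_phi_J0[OF tau0_mem[OF J]] .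
    moreover have "(\<lambda>i. lam (r i) * vf (r i) x) \<longlonglongrightarrow> \<mu> * w x"
      by (intro tendsto_mult mu w x)
    ultimately show ?thesis by (rule LIMSEQ_unique)
  qed
  have "bounded (w ` Lam)"
    unfolding bounded_iff using wb by (intro exI[of _ 1]) auto
  moreover have "\<exists>x\<in>Lam. w x \<noteq> 0"
    using one_Lam \<open>w 1 = 1\<close> by (intro bexI[of _ 1]) simp_all
  ultimately have fe: "field_eigenvector g (L_phi_B g) w \<mu>"
    unfolding field_eigenvector_def bounded_fields_def using eig by blast
  show ?thesis
  proof (intro exI conjI)
    \<comment> \<open>The subsequence is shifted by one because \<open>lam m\<close> and
      \<open>vf m\<close> belong to n = m + 1. The limit \<open>w\<close> itself serves as
      \<open>v\<close>.\<close>
    show "strict_mono (\<lambda>i. Suc (r i))" using r(1) by (simp add: strict_mono_def)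
    show "\<forall>i. Suc (r i) \<ge> 1" by simp
    show "(\<lambda>i. lam (r i)) \<longlonglongrightarrow> \<mu>" by (rule mu)
    show "\<forall>a\<in>orb. (\<lambda>i. vf (r i) a) \<longlonglongrightarrow> w a" using w orb_Lam by blast
    show "continuous_on Lam w" by (rule cont)
    show "\<forall>a\<in>orb. w a = w a" by blast
    show "\<forall>u. continuous_on Lam u \<and> (\<forall>a\<in>orb. u a = w a) \<longrightarrow> (\<forall>x\<in>Lam. u x = w x)"
      using uniq by blast
    show "field_eigenvector g (L_phi_B g) w \<mu>" by (rule fe)
  qed
qed

end

theorem propositionE:
  fixes g :: "real \<Rightarrow> real"
  assumes "feigenbaum_map g"
    and "concave_on {-1..1} g"
  shows "\<exists>(r :: nat \<Rightarrow> nat) (\<mu> :: real) (v :: real \<Rightarrow> real).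
           strict_mono r \<and> (\<forall>i. r i \<ge> 1) \<and>
           (\<lambda>i. lambda_approx g (r i)) \<longlonglongrightarrow> \<mu> \<and>
           (\<forall>a \<in> crit_orbit g. (\<lambda>i. v_fun g (r i) a) \<longlonglongrightarrow> v a) \<and>
           (\<exists>w :: real \<Rightarrow> real.
              continuous_on (feig_Lambda g) w \<and> (\<forall>a \<in> crit_orbit g. w a = v a) \<and>
              (\<forall>u. continuous_on (feig_Lambda g) u \<and> (\<forall>a \<in> crit_orbit g. u a = v a) \<longrightarrow>
                   (\<forall>x \<in> feig_Lambda g. u x = w x)) \<and>
              field_eigenvector g (L_phi_B g) w \<mu>)"
proof -
  interpret concave_feigenbaum g using assms by unfold_locales
  show ?thesis by (rule eigenfunction_exists)
qed

end
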